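(* Let $\Sigma_A$ be an irreducible subshift of finite type on the alphabet $\mathcal{J}=\{0,1,\dots,M-1\}$, with associated contracting similarities $S_i(x)=r_iT_i(x)+v_i$ ($i\in\mathcal{J}$) of $\mathbb{R}^2$, such that at least one $F_A^i$ ($i\in\mathcal{J}$) contains at least two points, and let $j\in\mathcal{J}$. Then for every $\varepsilon>0$ there exist $r\in(0,1)$, an orthogonal transformation $O\in\mathcal{T}_{j,A}^G\cap\mathbb{SO}_2$ and a self-similar iterated function system (SS-IFS) $\{\widetilde S_i\}_{i=1}^m$, $\widetilde S_i(x)=\widetilde r_i\widetilde T_i(x)+\widetilde v_i$, in $\mathbb{R}^2$ that satisfies the strong separation condition, with attractor $K$, such that $K\subseteq F_A^j\subseteq F_A$, $\dim_H F_A-\varepsilon<\dim_H K$, the transformation group $\mathcal{T}$ of $\{\widetilde S_i\}_{i=1}^m$ is dense in $\mathcal{T}_{j,A}^G\cap\mathbb{SO}_2$, and $\widetilde T_i=O$ and $\widetilde r_i=r$ for every $i\in\{1,\dots,m\}$.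
   Context: Subshifts of finite type. Let $\mathcal{J}=\{0,1,\dots,M-1\}$ and let $A$ be an $M\times M$ matrix indexed by $\mathcal{J}\times\mathcal{J}$ with entries in $\{0,1\}$. Put $\Sigma_A=\{\alpha=(\alpha_0,\alpha_1,\dots)\in\mathcal{J}^{\mathbb{N}}:A_{\alpha_i,\alpha_{i+1}}=1\text{ for all }i=0,1,\dots\}$. $\Sigma_A$ is irreducible if for all $i,j\in\mathcal{J}$ there is a positive integer $n$ with $(A^n)_{i,j}>0$. To each $i\in\mathcal{J}$ is associated a contracting similarity $S_i(x)=r_iT_i(x)+v_i$ of $\mathbb{R}^2$ with $r_i\in(0,1)$, $T_i\in\mathbb{O}_2$ (the orthogonal group), $v_i\in\mathbb{R}^2$. For $\alpha\in\mathcal{J}^{\mathbb{N}}$ let $\Pi(\alpha)=\lim_{k\to\infty}S_{\alpha_0}\circ\cdots\circ S_{\alpha_{k-1}}(0)$. Put $F_A=\Pi(\Sigma_A)$ and $F_A^j=\Pi(\{\alpha\in\Sigma_A:\alpha_0=j\})$. The $j$-th transformation group $\mathcal{T}_{j,A}^G$ is the group generated by all $T_{\alpha_0}\circ T_{\alpha_1}\circ\cdots\circ T_{\alpha_{k-1}}$ where $k\ge1$, $(\alpha_0,\dots,\alpha_{k-1})\in\mathcal{J}^k$, $\alpha_0=j$, $A_{\alpha_i,\alpha_{i+1}}=1$ for $0\le i\le k-2$, and $A_{\alpha_{k-1},j}=1$. Self-similar systems. An SS-IFS in $\mathbb{R}^2$ is a finite collection $\{\widetilde S_i\}_{i=1}^m$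 of contracting similarities of $\mathbb{R}^2$, $\widetilde S_i(x)=\widetilde r_i\widetilde T_i(x)+\widetilde v_i$ with $0<\widetilde r_i<1$, $\widetilde T_i\in\mathbb{O}_2$, $\widetilde v_i\in\mathbb{R}^2$. Its attractor is the unique nonempty compact $K$ with $K=\bigcup_{i=1}^m\widetilde S_i(K)$; the strong separation condition (SSC) means that the sets $\widetilde S_1(K),\dots,\widetilde S_m(K)$ are pairwise disjoint. The transformation group $\mathcal{T}$ is the group generated by $\widetilde T_1,\dots,\widetilde T_m$. $\dim_H$ is Hausdorff dimension; $\mathbb{SO}_2$ is the special orthogonal group. Density is with respect to the usual topology of $\mathbb{O}_2$; "$\mathcal T$ is dense in $\mathcal{T}_{j,A}^G\cap\mathbb{SO}_2$" means $\mathcal T$ is a dense subset of it. *)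

theory Defs
  imports
    "Jordan_Normal_Form.Matrix"
    "HOL-Algebra.Generated_Groups"
    "HOL-Analysis.Analysis"
begin

text \<open>Matrices over the alphabet \<open>{..<M}\<close> are the \<open>mat\<close> type of \<open>Jordan_Normal_Form\<close>,
  whereas the Euclidean plane and its linear maps use the type-indexed vectors of
  \<open>HOL-Analysis\<close>.\<close>

no_notation Matrix.vec_index (infixl "$" 100)
no_notation Matrix.scalar_prod (infix "\<bullet>" 70)
hide_type (open) Matrix.vec
hide_const (open) Matrix.vec Matrix.row Matrix.col Matrix.rows Matrix.mat

text \<open>The case distinction implements the conventions \<open>\<bar>{}\<bar>\<^sup>s = 0\<close> and \<open>0\<^sup>0 = 1\<close>
  for nonempty sets of diameter zero, which \<open>powr\<close> does not follow.\<close>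

definition diameter_power :: "real \<Rightarrow> 'a::metric_space set \<Rightarrow> real" where
  "diameter_power s U = (if U = {} then 0 else if s = 0 then 1 else diameter U powr s)"

text \<open>Boundedness of the covering sets is demanded explicitly because \<open>diameter\<close> is
  an unspecified real number on unbounded sets.\<close>

definition hausdorff_premeasure :: "real \<Rightarrow> real \<Rightarrow> 'a::metric_space set \<Rightarrow> ennreal" where
  "hausdorff_premeasure s \<delta> E =
     (INF U \<in> {U :: nat \<Rightarrow> 'a set. E \<subseteq> (\<Union>i. U i) \<and> (\<forall>i. bounded (U i) \<and> diameter (U i) \<le> \<delta>)}.
        (\<Sum>i. ennreal (diameter_power s (U i))))"

definition hausdorff_measure :: "real \<Rightarrow> 'a::metric_space set \<Rightarrow> ennreal" where
  "hausdorff_measure s E = (SUP \<delta> \<in> {0<..}. hausdorff_premeasure s \<delta> E)"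

definition hausdorff_dim :: "'a::metric_space set \<Rightarrow> ereal" where
  "hausdorff_dim E = Inf {ereal s | s. 0 \<le> s \<and> hausdorff_measure s E = 0}"

definition orthogonal_group :: "(real^'n^'n) monoid" where
  "orthogonal_group = \<lparr>carrier = {Q. orthogonal_matrix Q}, mult = (**), one = mat 1\<rparr>"

lemma group_orthogonal_group: "group (orthogonal_group :: (real^'n^'n) monoid)"
proof (rule groupI)
  fix Q :: "real^'n^'n"
  assume "Q \<in> carrier orthogonal_group"
  then show "\<exists>P\<in>carrier orthogonal_group. P \<otimes>\<^bsub>orthogonal_group\<^esub> Q = \<one>\<^bsub>orthogonal_group\<^esub>"
    by (intro bexI[of _ "transpose Q"])
      (auto simp: orthogonal_group_def orthogonal_matrix_def)
qed (auto simp: orthogonal_group_def orthogonal_matrix_mul orthogonal_matrix_id matrix_mul_assoc)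

definition similarity :: "real \<Rightarrow> real^'n^'n \<Rightarrow> real^'n \<Rightarrow> real^'n \<Rightarrow> real^'n" where
  "similarity r T v x = r *\<^sub>R (T *v x) + v"

definition zero_one_matrix :: "nat \<Rightarrow> nat mat \<Rightarrow> bool" where
  "zero_one_matrix M A \<longleftrightarrow> A \<in> carrier_mat M M \<and> (\<forall>i<M. \<forall>j<M. A $$ (i, j) \<in> {0, 1})"

definition sft :: "nat \<Rightarrow> nat mat \<Rightarrow> (nat \<Rightarrow> nat) set" where
  "sft M A = {\<alpha>. (\<forall>i. \<alpha> i < M) \<and> (\<forall>i. A $$ (\<alpha> i, \<alpha> (Suc i)) = 1)}"

definition irreducible_sft :: "nat \<Rightarrow> nat mat \<Rightarrow> bool" where
  "irreducible_sft M A \<longleftrightarrow> (\<forall>i<M. \<forall>j<M. \<exists>n>0. (A ^\<^sub>m n) $$ (i, j) > 0)"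

definition coding_map :: "(nat \<Rightarrow> 'a \<Rightarrow> 'a) \<Rightarrow> (nat \<Rightarrow> nat) \<Rightarrow> 'a::{t2_space,zero}" where
  "coding_map S \<alpha> = lim (\<lambda>k. foldr (\<circ>) (map (\<lambda>i. S (\<alpha> i)) [0..<k]) id 0)"

definition sft_attractor :: "nat \<Rightarrow> nat mat \<Rightarrow> (nat \<Rightarrow> 'a \<Rightarrow> 'a) \<Rightarrow> 'a::{t2_space,zero} set" where
  "sft_attractor M A S = coding_map S ` sft M A"

definition sft_attractor_at ::
    "nat \<Rightarrow> nat mat \<Rightarrow> (nat \<Rightarrow> 'a \<Rightarrow> 'a) \<Rightarrow> nat \<Rightarrow> 'a::{t2_space,zero} set" where
  "sft_attractor_at M A S j = coding_map S ` {\<alpha> \<in> sft M A. \<alpha> 0 = j}"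

definition loops_at :: "nat \<Rightarrow> nat mat \<Rightarrow> nat \<Rightarrow> nat list set" where
  "loops_at M A j = {w. w \<noteq> [] \<and> set w \<subseteq> {..<M} \<and> hd w = j \<and>
     (\<forall>i. Suc i < length w \<longrightarrow> A $$ (w ! i, w ! Suc i) = 1) \<and> A $$ (last w, j) = 1}"

definition sft_transformation_group ::
    "nat \<Rightarrow> nat mat \<Rightarrow> (nat \<Rightarrow> real^'n^'n) \<Rightarrow> nat \<Rightarrow> (real^'n^'n) set" where
  "sft_transformation_group M A T j =
     generate orthogonal_group
       ((\<lambda>w. foldr (**) (map T w) (mat 1)) ` loops_at M A j)"

definition ss_ifs ::
    "nat \<Rightarrow> (nat \<Rightarrow> real) \<Rightarrow> (nat \<Rightarrow> real^'n^'n) \<Rightarrow> (nat \<Rightarrow> real^'n) \<Rightarrow> (nat \<Rightarrow> real^'n \<Rightarrow> real^'n) \<Rightarrow> bool"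
where
  "ss_ifs m r T v S \<longleftrightarrow> 1 \<le> m \<and>
     (\<forall>i\<in>{1..m}. 0 < r i \<and> r i < 1 \<and> orthogonal_matrix (T i) \<and> S i = similarity (r i) (T i) (v i))"

definition is_attractor :: "nat \<Rightarrow> (nat \<Rightarrow> 'a \<Rightarrow> 'a) \<Rightarrow> 'a::topological_space set \<Rightarrow> bool" where
  "is_attractor m S K \<longleftrightarrow> K \<noteq> {} \<and> compact K \<and> K = (\<Union>i\<in>{1..m}. S i ` K)"

definition strong_separation :: "nat \<Rightarrow> (nat \<Rightarrow> 'a \<Rightarrow> 'a) \<Rightarrow> 'a set \<Rightarrow> bool" where
  "strong_separation m S K \<longleftrightarrow> disjoint_family_on (\<lambda>i. S i ` K) {1..m}"

definition ifs_transformation_group :: "nat \<Rightarrow> (nat \<Rightarrow> real^'n^'n) \<Rightarrow> (real^'n^'n) set" where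
  "ifs_transformation_group m T = generate orthogonal_group (T ` {1..m})"

definition dense_subset :: "'a::topological_space set \<Rightarrow> 'a set \<Rightarrow> bool" where
  "dense_subset D X \<longleftrightarrow> D \<subseteq> X \<and> X \<subseteq> closure D"

end

theory Submission
  imports Defs
begin

text \<open>
  The maps of the approximating system are compositions along loops at \<open>j\<close> of the transition graph. Such a
  composition maps the closed set \<open>F\<^sub>A\<^sup>j\<close> into itself, so that the attractor of any finite family of
  them lies in \<open>F\<^sub>A\<^sup>j\<close>. Fix \<open>s\<close> between \<open>dim F\<^sub>A - \<epsilon>\<close> and \<open>dim F\<^sub>A\<close>. It remains to find \<open>m\<close> loops
  that have the same ratio \<open>\<rho>\<close> with \<open>m \<rho> powr s \<ge> 1\<close>, have the same rotation, generating a dense subgroup, and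
  map a large ball to pairwise disjoint sets. Then the attractor has dimension at least \<open>s\<close>, because
  expansions in base \<open>m\<close> parametrise it by the unit interval with a controlled modulus
  (\<open>equal_ratio_attractor\<close>).

  \<^emph>\<open>Many disjoint pieces.\<close> The pieces of the given system may overlap, but in a maximal disjoint
  subfamily of the pieces of size about \<open>\<delta>\<close>, the enlarged pieces cover \<open>F\<^sub>A\<close>. By the definition of the
  dimension the subfamily has at least about \<open>\<delta> powr (- t)\<close> members for every \<open>t < dim F\<^sub>A\<close>. Irreducibility
  extends the words to loops at \<open>j\<close> that preserve orientation, at the cost of bounded factors, which
  are negligible when \<open>s < t\<close> and \<open>\<delta>\<close> is small (\<open>exists_separated_rotation_loops\<close>).

  \<^emph>\<open>Equal linear parts.\<close> The linear part of an orientation preserving similarity is multiplication by a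
  complex number. As these commute, the linear part of a concatenation of \<open>k\<close> out of \<open>n\<close> loops only
  depends on how often each loop occurs. So the \<open>n ^ k\<close> concatenations have at most \<open>(k + 1) ^ n\<close>
  different linear parts, and the most frequent one is frequent enough when \<open>k\<close> is large
  (\<open>exists_common_multiplier\<close>).

  \<^emph>\<open>Density.\<close> A rotation of infinite order generates a dense subgroup of all rotations. If all
  rotations along loops have finite order, then the linear parts of loops form a group, which is
  finitely generated since the graph is finite. It follows that its rotations form a finite cyclic group. In
  both cases there is one loop that, appended to a suitable high power of the common rotation found
  before, corrects it to a rotation that generates a dense subgroup (\<open>exists_dense_rotation\<close>,
  \<open>exists_dense_loop\<close>). Its ratio does not matter for high powers (\<open>exists_self_similar_subset\<close>).
\<close>

section \<open>Hausdorff dimension from below\<close>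

lemma hausdorff_dim_nonneg: "0 \<le> hausdorff_dim E"
  unfolding hausdorff_dim_def by (intro Inf_greatest) auto

text \<open>A nonzero Hausdorff measure in dimension \<open>t\<close> forbids cheap covers. For \<open>t < 0\<close>, where there is no
  such measure, the bound only says that a cover of a nonempty set has a member; including this
  case keeps the later estimates uniform when the dimension is \<open>0\<close>.\<close>

lemma finite_cover_card_lower_bound:
  fixes E :: "'a::metric_space set"
  assumes "E \<noteq> {}" and t: "ereal t < hausdorff_dim E"
  shows "\<exists>c>0. \<exists>\<delta>0>0. \<forall>\<delta> \<U>. 0 < \<delta> \<longrightarrow> \<delta> \<le> \<delta>0 \<longrightarrow> finite \<U> \<longrightarrow> E \<subseteq> \<Union>\<U> \<longrightarrow>
           (\<forall>U\<in>\<U>. bounded U \<and> diameter U \<le> \<delta>) \<longrightarrow> c \<le> real (card \<U>) * \<delta> powr t"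
proof (cases "t < 0")
  case True
  have "1 \<le> real (card \<U>) * \<delta> powr t"
    if "0 < \<delta>" "\<delta> \<le> 1" "finite \<U>" "E \<subseteq> \<Union>\<U>" for \<delta> and \<U> :: "'a set set"
  proof -
    have "\<U> \<noteq> {}" using that \<open>E \<noteq> {}\<close> by auto
    with that have "0 < card \<U>" by (simp add: card_gt_0_iff)
    then have "1 \<le> real (card \<U>)" by linarith
    moreover have "1 \<le> \<delta> powr t"
      using that True powr_mono'[of t 0 \<delta>] by simp
    ultimately show ?thesis using mult_mono[of 1 "real (card \<U>)" 1 "\<delta> powr t"] by simp
  qed
  then show ?thesis by (intro exI[of _ "1::real"]) (auto intro!: exI[of _ "1::real"])
next
  case False
  then have t0: "0 \<le> t" by simp
  have "hausdorff_measure t E \<noteq> 0"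
  proof
    assume "hausdorff_measure t E = 0"
    then have "hausdorff_dim E \<le> ereal t"
      unfolding hausdorff_dim_def using t0 by (intro Inf_lower) auto
    with t show False by simp
  qed
  then obtain \<delta>0 where \<delta>0: "0 < \<delta>0" "hausdorff_premeasure t \<delta>0 E \<noteq> 0"
    unfolding hausdorff_measure_def by (auto simp: SUP_bot_conv bot_ennreal[symmetric])
  define p where "p = min (hausdorff_premeasure t \<delta>0 E) 1"
  have p: "p \<noteq> 0" "p \<noteq> top_class.top" using \<delta>0 by (auto simp: p_def min_def top_unique)
  have "enn2real p \<le> real (card \<U>) * \<delta> powr t"
    if \<delta>: "0 < \<delta>" "\<delta> \<le> \<delta>0" and "finite \<U>" "E \<subseteq> \<Union>\<U>"
      and U: "\<forall>U\<in>\<U>. bounded U \<and> diameter U \<le> \<delta>" for \<delta> and \<U> :: "'a set set"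
  proof -
    obtain g where g: "bij_betw g {..<card \<U>} \<U>"
      using ex_bij_betw_nat_finite[OF \<open>finite \<U>\<close>] atLeast0LessThan by auto
    define V where "V = (\<lambda>i. if i < card \<U> then g i else {})"
    \<comment> \<open>padding with empty sets, whose diameter power is zero, turns the finite cover into a sequence\<close>
    have "(\<Union>i. V i) = \<Union>\<U>"
      using g unfolding V_def bij_betw_def by auto
    moreover have gU: "g i \<in> \<U>" if "i < card \<U>" for i using g that by (auto simp: bij_betw_def)
    have "bounded (V i) \<and> diameter (V i) \<le> \<delta>0" for i
      using gU[of i] U \<delta> by (auto simp: V_def intro: order_trans)
    ultimately have "hausdorff_premeasure t \<delta>0 E \<le> (\<Sum>i. ennreal (diameter_power t (V i)))"
      unfolding hausdorff_premeasure_def using \<open>E \<subseteq> \<Union>\<U>\<close> by (intro INF_lower) auto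
    also have "\<dots> = (\<Sum>i<card \<U>. ennreal (diameter_power t (V i)))"
      by (rule suminf_finite) (auto simp: V_def diameter_power_def)
    also have "\<dots> \<le> (\<Sum>i<card \<U>. ennreal (\<delta> powr t))"
    proof (intro sum_mono ennreal_leI)
      fix i assume "i \<in> {..<card \<U>}"
      then have "bounded (V i)" "diameter (V i) \<le> \<delta>" using gU[of i] U by (auto simp: V_def)
      then show "diameter_power t (V i) \<le> \<delta> powr t"
        using t0 \<delta> by (auto simp: diameter_power_def intro!: powr_mono2 diameter_ge_0)
    qed
    also have "\<dots> = ennreal (real (card \<U>) * \<delta> powr t)"
      by (simp add: ennreal_mult ennreal_of_nat_eq_real_of_nat)
    finally have "p \<le> ennreal (real (card \<U>) * \<delta> powr t)" by (simp add: p_def min.coboundedI1)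
    then show ?thesis by (intro enn2real_leI) auto
  qed
  moreover have "0 < enn2real p" using p by (simp add: enn2real_positive_iff less_top zero_less_iff_neq_zero)
  ultimately show ?thesis using \<delta>0(1) by blast
qed

text \<open>This replaces the mass distribution principle: a cover of \<open>K\<close> pulls back along \<open>h\<close> to a cover of
  the unit interval by sets of diameter at most \<open>C\<close> times the \<open>s\<close>-th powers of the diameters, and
  Lebesgue measure is countably subadditive. Each pulled back set is
  enclosed in an interval, which is measurable.\<close>

lemma hausdorff_dim_ge_of_interval_parametrisation:
  fixes K :: "'a::metric_space set"
  assumes hK: "\<And>t. t \<in> {0..<1} \<Longrightarrow> h t \<in> K" and C: "0 < C" and s: "0 < s"
    and h: "\<And>t u. t \<in> {0..<1} \<Longrightarrow> u \<in> {0..<1} \<Longrightarrow> \<bar>t - u\<bar> \<le> C * dist (h t) (h u) powr s"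
  shows "ereal s \<le> hausdorff_dim K"
  unfolding hausdorff_dim_def
proof (rule Inf_greatest, clarsimp)
  fix s' assume s': "0 \<le> s'" and null: "hausdorff_measure s' K = 0"
  show "s \<le> s'"
  proof (rule ccontr)
    assume "\<not> s \<le> s'"
    define a where "a = s' / s"
    have a: "0 \<le> a" "a < 1" using s s' \<open>\<not> s \<le> s'\<close> by (auto simp: a_def)
    \<comment> \<open>the same kind of estimate with every smaller exponent, because distances in the interval are at most 1\<close>
    have holder: "\<bar>t - u\<bar> \<le> C powr a * diameter_power s' U"
      if "t \<in> {0..<1}" "u \<in> {0..<1}" "h t \<in> U" "h u \<in> U" "bounded U" for t u U
    proof (cases "t = u")
      case True then show ?thesis by (auto simp: diameter_power_def)
    next
      case False
      have *: "\<bar>t - u\<bar> \<le> \<bar>t - u\<bar> powr a"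
        using that False a powr_mono'[of a 1 "\<bar>t - u\<bar>"] by auto
      also have "\<dots> \<le> (C * dist (h t) (h u) powr s) powr a"
        using h that a by (intro powr_mono2) auto
      also have "\<dots> = C powr a * dist (h t) (h u) powr s'"
        using C s by (simp add: powr_mult powr_powr a_def)
      also have "\<dots> \<le> C powr a * diameter_power s' U"
      proof (cases "s' = 0")
        case True
        then show ?thesis using that by (auto simp: diameter_power_def powr_def)
      next
        case False
        then show ?thesis using that s'
          by (auto simp: diameter_power_def intro!: mult_left_mono powr_mono2 diameter_bounded_bound)
      qed
      finally show ?thesis .
    qed
    have "ennreal (1 / (2 * C powr a)) \<le> hausdorff_premeasure s' 1 K"
      unfolding hausdorff_premeasure_def
    proof (intro INF_greatest, clarsimp)
      fix U :: "nat \<Rightarrow> 'a set"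
      assume cover: "K \<subseteq> (\<Union>i. U i)" and U: "\<forall>i. bounded (U i) \<and> diameter (U i) \<le> 1"
      define V where "V = (\<lambda>i. {t \<in> {0..<1::real}. h t \<in> U i})"
      define l where "l = (\<lambda>i. C powr a * diameter_power s' (U i))"
      have l0: "0 \<le> l i" for i by (auto simp: l_def diameter_power_def)
      define W where "W = (\<lambda>i. if V i = {} then {} else cball (SOME t. t \<in> V i) (l i))"
      have VW: "V i \<subseteq> W i" for i
      proof
        fix t assume t: "t \<in> V i"
        then have "(SOME t. t \<in> V i) \<in> V i" by (auto intro: someI)
        with t show "t \<in> W i" using holder[of "SOME t. t \<in> V i" t "U i"] U
          by (auto simp: W_def V_def l_def dist_real_def)
      qed
      have "{0..<1} \<subseteq> (\<Union>i. W i)"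
      proof
        fix t :: real assume t: "t \<in> {0..<1}"
        then have "h t \<in> (\<Union>i. U i)" using hK cover by blast
        then show "t \<in> (\<Union>i. W i)" using t VW by (auto simp: V_def)
      qed
      have W: "W i \<in> sets lborel" for i by (auto simp: W_def)
      have W2: "emeasure lborel (W i) \<le> ennreal (2 * C powr a) * ennreal (diameter_power s' (U i))" for i
      proof -
        have "emeasure lborel (W i) \<le> ennreal (2 * l i)"
          using l0[of i] by (auto simp: W_def cball_eq_atLeastAtMost)
        also have "\<dots> = ennreal (2 * C powr a) * ennreal (diameter_power s' (U i))"
          by (subst ennreal_mult[symmetric]) (auto simp: l_def diameter_power_def)
        finally show ?thesis .
      qed
      have "1 = emeasure lborel {0..<1::real}" by simp
      also have "\<dots> \<le> emeasure lborel (\<Union>i. W i)"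
        using W \<open>{0..<1} \<subseteq> (\<Union>i. W i)\<close> by (intro emeasure_mono) auto
      also have "\<dots> \<le> (\<Sum>i. emeasure lborel (W i))"
        using W by (intro emeasure_subadditive_countably) auto
      also have "\<dots> \<le> (\<Sum>i. ennreal (2 * C powr a) * ennreal (diameter_power s' (U i)))"
        using W2 by (intro suminf_le) auto
      also have "\<dots> = ennreal (2 * C powr a) * (\<Sum>i. ennreal (diameter_power s' (U i)))"
        by (rule ennreal_suminf_cmult)
      finally have "ennreal (1 / (2 * C powr a)) * 1 \<le> ennreal (1 / (2 * C powr a)) *
          (ennreal (2 * C powr a) * (\<Sum>i. ennreal (diameter_power s' (U i))))"
        by (intro mult_left_mono) auto
      also have "\<dots> = (\<Sum>i. ennreal (diameter_power s' (U i)))"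
        using C by (simp add: mult.assoc[symmetric] ennreal_mult[symmetric])
      finally show "ennreal (1 / (2 * C powr a)) \<le> (\<Sum>i. ennreal (diameter_power s' (U i)))" by simp
    qed
    also have "\<dots> \<le> hausdorff_measure s' K"
      unfolding hausdorff_measure_def by (intro SUP_upper) auto
    finally show False using null C by (simp add: ennreal_eq_0_iff)
  qed
qed

section \<open>Coding by contracting similarities\<close>

text \<open>Words and sequences of symbols are ordered as in the coding map: the first letter names the map
  that is applied last.\<close>

definition comp_word :: "(nat \<Rightarrow> 'a \<Rightarrow> 'a) \<Rightarrow> nat list \<Rightarrow> 'a \<Rightarrow> 'a" where
  "comp_word S w = foldr (\<circ>) (map S w) id"

lemma comp_word_simps [simp]:
  "comp_word S [] = id" "comp_word S (i # w) = S i \<circ> comp_word S w"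
  by (auto simp: comp_word_def)

lemma comp_word_append: "comp_word S (u @ w) = comp_word S u \<circ> comp_word S w"
  by (induction u) auto

definition prefix_of :: "(nat \<Rightarrow> nat) \<Rightarrow> nat \<Rightarrow> nat list" where
  "prefix_of \<alpha> k = map \<alpha> [0..<k]"

definition shift :: "nat \<Rightarrow> (nat \<Rightarrow> nat) \<Rightarrow> nat \<Rightarrow> nat" where
  "shift k \<alpha> = (\<lambda>i. \<alpha> (i + k))"

lemma prefix_of_0 [simp]: "prefix_of \<alpha> 0 = []"
  and length_prefix_of [simp]: "length (prefix_of \<alpha> k) = k"
  by (auto simp: prefix_of_def)

lemma prefix_of_Suc: "prefix_of \<alpha> (Suc k) = \<alpha> 0 # prefix_of (shift 1 \<alpha>) k"
  by (simp add: prefix_of_def shift_def upt_conv_Cons map_Suc_upt[symmetric] del: upt_Suc)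

lemma prefix_of_Suc': "prefix_of \<alpha> (Suc k) = prefix_of \<alpha> k @ [\<alpha> k]"
  by (simp add: prefix_of_def)

lemma prefix_of_add: "prefix_of \<alpha> (k + l) = prefix_of \<alpha> k @ prefix_of (shift k \<alpha>) l"
  by (induction l) (auto simp: prefix_of_Suc' shift_def add.commute)

lemma coding_map_eq: "coding_map S \<alpha> = lim (\<lambda>k. comp_word S (prefix_of \<alpha> k) 0)"
  by (simp add: coding_map_def comp_word_def prefix_of_def comp_def)

lemma shift_simps: "shift 0 \<alpha> = \<alpha>" "shift k \<alpha> i = \<alpha> (i + k)"
  by (auto simp: shift_def)

text \<open>The ball of radius \<open>R\<close> is mapped into itself by every map. It serves as a common neighbourhood of
  all limit points, so that its images under compositions localise the coding map. The same
  assumptions are met twice: by the given similarities, and by the compositions along loops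
  from which the approximating system is built.\<close>

locale contracting_similarities =
  fixes I :: "nat set" and S :: "nat \<Rightarrow> 'a::euclidean_space \<Rightarrow> 'a"
    and r :: "nat \<Rightarrow> real" and c R :: real
  assumes fin: "finite I" and c1: "c < 1" and R0: "0 < R"
    and r0: "\<And>i. i \<in> I \<Longrightarrow> 0 < r i" and rc: "\<And>i. i \<in> I \<Longrightarrow> r i \<le> c"
    and sim: "\<And>i x y. i \<in> I \<Longrightarrow> dist (S i x) (S i y) = r i * dist x y"
    and inv_ball: "\<And>i x. i \<in> I \<Longrightarrow> norm x \<le> R \<Longrightarrow> norm (S i x) \<le> R"
begin

definition ratio :: "nat list \<Rightarrow> real" where "ratio w = prod_list (map r w)"

lemma ratio_simps [simp]: "ratio [] = 1" "ratio (i # w) = r i * ratio w"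
    "ratio (u @ w) = ratio u * ratio w"
  by (auto simp: ratio_def)

lemma ratio_pos: "set w \<subseteq> I \<Longrightarrow> 0 < ratio w"
  by (induction w) (auto simp: r0)

lemma ratio_le: "set w \<subseteq> I \<Longrightarrow> ratio w \<le> c ^ length w"
proof (induction w)
  case (Cons i w)
  then show ?case using ratio_pos[of w] r0[of i] rc[of i] by (auto intro!: mult_mono)
qed auto

lemma ratio_le_1: "set w \<subseteq> I \<Longrightarrow> ratio w \<le> 1"
proof (induction w)
  case (Cons i w)
  then show ?case using ratio_pos[of w] r0[of i] rc[of i] c1 by (auto intro!: mult_le_one)
qed auto

lemma dist_comp_word: "set w \<subseteq> I \<Longrightarrow> dist (comp_word S w x) (comp_word S w y) = ratio w * dist x y"
  by (induction w) (auto simp: sim)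

lemma inj_comp_word: "set w \<subseteq> I \<Longrightarrow> inj (comp_word S w)"
  using dist_comp_word[of w] ratio_pos[of w]
  by (intro injI) (metis dist_eq_0_iff less_irrefl mult_eq_0_iff)

lemma comp_word_ball: "set w \<subseteq> I \<Longrightarrow> x \<in> cball 0 R \<Longrightarrow> comp_word S w x \<in> cball 0 R"
  by (induction w) (auto simp: inv_ball)

lemma continuous_comp_word: "set w \<subseteq> I \<Longrightarrow> continuous_on X (comp_word S w)"
proof -
  assume w: "set w \<subseteq> I"
  have "lipschitz_on (ratio w) X (comp_word S w)"
    using dist_comp_word[OF w] ratio_pos[OF w] by (intro lipschitz_onI) auto
  then show ?thesis by (rule lipschitz_on_continuous_on)
qed

abbreviation sequences :: "(nat \<Rightarrow> nat) set" where "sequences \<equiv> {\<alpha>. \<forall>i. \<alpha> i \<in> I}"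

lemma set_prefix_of: "\<alpha> \<in> sequences \<Longrightarrow> set (prefix_of \<alpha> k) \<subseteq> I"
  by (auto simp: prefix_of_def)

lemma shift_sequences: "\<alpha> \<in> sequences \<Longrightarrow> shift k \<alpha> \<in> sequences"
  by (auto simp: shift_def)

lemma c0: "I \<noteq> {} \<Longrightarrow> 0 < c"
  using r0 rc by (meson ex_in_conv less_le_trans)

lemma pow_c_tendsto: "I \<noteq> {} \<Longrightarrow> (\<lambda>k. C * c ^ k) \<longlonglongrightarrow> 0"
  using c0 c1 by (intro tendsto_mult_right_zero LIMSEQ_power_zero) auto

text \<open>The partial compositions at \<open>0\<close> form a Cauchy sequence, as a composition of length \<open>k\<close> contracts by
  at least \<open>c ^ k\<close> and all later points stay in the ball. Without this, \<open>lim\<close> would be meaningless.\<close>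

lemma coding_limit:
  assumes \<alpha>: "\<alpha> \<in> sequences"
  shows "(\<lambda>k. comp_word S (prefix_of \<alpha> k) 0) \<longlonglongrightarrow> coding_map S \<alpha>"
proof -
  have I: "I \<noteq> {}" using \<alpha> by auto
  have step: "dist (comp_word S (prefix_of \<alpha> (k + l)) 0) (comp_word S (prefix_of \<alpha> k) 0) \<le> R * c ^ k" for k l
  proof -
    have "dist (comp_word S (prefix_of \<alpha> (k + l)) 0) (comp_word S (prefix_of \<alpha> k) 0)
        = ratio (prefix_of \<alpha> k) * dist (comp_word S (prefix_of (shift k \<alpha>) l) 0) 0"
      by (simp add: prefix_of_add comp_word_append dist_comp_word set_prefix_of[OF \<alpha>])
    also have "\<dots> \<le> c ^ k * R"
    proof (intro mult_mono)
      show "ratio (prefix_of \<alpha> k) \<le> c ^ k"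
        using ratio_le[OF set_prefix_of[OF \<alpha>, of k]] by simp
      show "dist (comp_word S (prefix_of (shift k \<alpha>) l) 0) 0 \<le> R"
        using comp_word_ball[OF set_prefix_of[OF shift_sequences[OF \<alpha>]], of 0 k l] R0
        by (simp add: dist_norm)
    qed (use c0[OF I] in auto)
    finally show ?thesis by (simp add: mult.commute)
  qed
  have "Cauchy (\<lambda>k. comp_word S (prefix_of \<alpha> k) 0)"
  proof (rule metric_CauchyI)
    fix e :: real assume "0 < e"
    then have "eventually (\<lambda>k. R * c ^ k < e / 2) sequentially"
      using pow_c_tendsto[OF I, of R] by (intro order_tendstoD(2)) auto
    then obtain N where N: "R * c ^ N < e / 2" by (auto simp: eventually_sequentially)
    show "\<exists>M. \<forall>m\<ge>M. \<forall>n\<ge>M. dist (comp_word S (prefix_of \<alpha> m) 0) (comp_word S (prefix_of \<alpha> n) 0) < e"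
    proof (intro exI[of _ N] allI impI)
      fix m n assume "m \<ge> N" "n \<ge> N"
      then obtain a b where "m = N + a" "n = N + b" by (auto simp: le_iff_add)
      then show "dist (comp_word S (prefix_of \<alpha> m) 0) (comp_word S (prefix_of \<alpha> n) 0) < e"
        using step[of N a] step[of N b] N
        by - (rule dist_triangle_half_l[of _ "comp_word S (prefix_of \<alpha> N) 0"], simp_all add: dist_commute)
    qed
  qed
  then have "convergent (\<lambda>k. comp_word S (prefix_of \<alpha> k) 0)" by (rule Cauchy_convergent)
  then show ?thesis unfolding coding_map_eq by (simp only: convergent_LIMSEQ_iff)
qed

lemma coding_map_ball: "\<alpha> \<in> sequences \<Longrightarrow> coding_map S \<alpha> \<in> cball 0 R"
proof -
  assume \<alpha>: "\<alpha> \<in> sequences"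
  have "comp_word S (prefix_of \<alpha> k) 0 \<in> cball 0 R" for k
    using comp_word_ball[OF set_prefix_of[OF \<alpha>], of 0 k] R0 by simp
  then show ?thesis
    by - (rule closed_sequentially[OF closed_cball _ coding_limit[OF \<alpha>]], blast)
qed

lemma coding_map_split:
  assumes \<alpha>: "\<alpha> \<in> sequences"
  shows "coding_map S \<alpha> = comp_word S (prefix_of \<alpha> k) (coding_map S (shift k \<alpha>))"
proof -
  have "(\<lambda>l. comp_word S (prefix_of \<alpha> k) (comp_word S (prefix_of (shift k \<alpha>) l) 0))
        \<longlonglongrightarrow> comp_word S (prefix_of \<alpha> k) (coding_map S (shift k \<alpha>))"
    by (rule continuous_on_tendsto_compose[OF continuous_comp_word[OF set_prefix_of[OF \<alpha>], of UNIV]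
          coding_limit[OF shift_sequences[OF \<alpha>]]]) auto
  moreover have "(\<lambda>l. comp_word S (prefix_of \<alpha> (l + k)) 0) \<longlonglongrightarrow> coding_map S \<alpha>"
    using coding_limit[OF \<alpha>] by (rule LIMSEQ_ignore_initial_segment)
  moreover have "comp_word S (prefix_of \<alpha> (l + k)) 0
      = comp_word S (prefix_of \<alpha> k) (comp_word S (prefix_of (shift k \<alpha>) l) 0)" for l
    by (subst add.commute) (simp add: prefix_of_add comp_word_append)
  ultimately show ?thesis by (simp add: LIMSEQ_unique)
qed

lemma dist_coding_map:
  assumes "\<alpha> \<in> sequences" "\<beta> \<in> sequences" "prefix_of \<alpha> k = prefix_of \<beta> k"
  shows "dist (coding_map S \<alpha>) (coding_map S \<beta>)
      = ratio (prefix_of \<alpha> k) * dist (coding_map S (shift k \<alpha>)) (coding_map S (shift k \<beta>))"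
  by (subst coding_map_split[OF assms(1), of k], subst coding_map_split[OF assms(2), of k],
      subst assms(3)[symmetric], rule dist_comp_word[OF set_prefix_of[OF assms(1)]])

lemma dist_coding_map_le:
  assumes "\<alpha> \<in> sequences" "\<beta> \<in> sequences" "prefix_of \<alpha> k = prefix_of \<beta> k"
  shows "dist (coding_map S \<alpha>) (coding_map S \<beta>) \<le> 2 * R * c ^ k"
proof -
  have I: "I \<noteq> {}" using assms by auto
  have "dist (coding_map S \<alpha>) (coding_map S \<beta>)
      = ratio (prefix_of \<alpha> k) * dist (coding_map S (shift k \<alpha>)) (coding_map S (shift k \<beta>))"
    by (rule dist_coding_map[OF assms])
  also have "\<dots> \<le> c ^ k * (R + R)"
  proof (intro mult_mono)
    show "ratio (prefix_of \<alpha> k) \<le> c ^ k"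
      using ratio_le[OF set_prefix_of[OF assms(1), of k]] by simp
    have "norm (coding_map S (shift k \<alpha>)) \<le> R" "norm (coding_map S (shift k \<beta>)) \<le> R"
      using assms coding_map_ball[OF shift_sequences] by auto
    then show "dist (coding_map S (shift k \<alpha>)) (coding_map S (shift k \<beta>)) \<le> R + R"
      using norm_triangle_ineq4[of "coding_map S (shift k \<alpha>)" "coding_map S (shift k \<beta>)"]
      by (simp add: dist_norm)
  qed (use c0[OF I] in auto)
  finally show ?thesis by (simp add: algebra_simps)
qed

lemma compact_sequences: "compact sequences"
proof -
  have "sequences = PiE UNIV (\<lambda>_. I)" by auto
  then have "compactin (product_topology (\<lambda>_. euclidean) UNIV) sequences"
    using fin by (auto simp: compactin_PiE finite_imp_compact)
  then show ?thesis by (simp add: euclidean_product_topology)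
qed

lemma continuous_coding_map: "continuous_on sequences (coding_map S)"
  unfolding continuous_on tendsto_iff
proof (intro ballI allI impI)
  fix \<alpha> e assume \<alpha>: "\<alpha> \<in> sequences" and "0 < (e::real)"
  then have "I \<noteq> {}" by auto
  from pow_c_tendsto[OF this, of "2 * R"] \<open>0 < e\<close>
  have "eventually (\<lambda>k. 2 * R * c ^ k < e) sequentially" by (intro order_tendstoD(2)) auto
  then obtain k where k: "2 * R * c ^ k < e" by (auto simp: eventually_sequentially)
  have "continuous_on sequences (\<lambda>\<beta>. \<beta> i)" for i :: nat
    by (rule continuous_on_subset[OF continuous_on_product_coordinates]) auto
  then have "eventually (\<lambda>\<beta>. \<beta> i = \<alpha> i) (at \<alpha> within sequences)" for i :: nat
    using \<alpha> by (auto simp: continuous_on tendsto_discrete)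
  then have "eventually (\<lambda>\<beta>. \<forall>i\<in>{0..<k}. \<beta> i = \<alpha> i) (at \<alpha> within sequences)"
    by (intro eventually_ball_finite) auto
  moreover have "eventually (\<lambda>\<beta>. \<beta> \<in> sequences) (at \<alpha> within sequences)"
    unfolding eventually_at_topological by (intro exI[of _ UNIV]) auto
  ultimately show "eventually (\<lambda>\<beta>. dist (coding_map S \<beta>) (coding_map S \<alpha>) < e) (at \<alpha> within sequences)"
  proof eventually_elim
    case (elim \<beta>)
    then have "prefix_of \<beta> k = prefix_of \<alpha> k" by (auto simp: prefix_of_def)
    with dist_coding_map_le[OF elim(2) \<alpha>] k show ?case by force
  qed
qed

text \<open>With the product of the discrete topologies, the sequences over a finite alphabet form a compact
  space (Tychonoff) on which the coding map is continuous. This yields compactness of attractors as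
  well as closedness of the pieces of the subshift attractor.\<close>

lemma compact_coding_image:
  assumes "closed X" "X \<subseteq> sequences"
  shows "compact (coding_map S ` X)"
proof (rule compact_continuous_image)
  show "continuous_on X (coding_map S)"
    using continuous_coding_map assms(2) by (rule continuous_on_subset)
  show "compact X"
    using compact_Int_closed[OF compact_sequences assms(1)] assms(2) by (simp add: Int_absorb1)
qed

end

context contracting_similarities
begin

lemma coding_map_unfold:
  assumes "\<alpha> \<in> sequences"
  shows "coding_map S \<alpha> = S (\<alpha> 0) (coding_map S (shift 1 \<alpha>))"
  using coding_map_split[OF assms, of 1] by (simp add: prefix_of_Suc)

lemma coding_map_Cons:
  assumes "i \<in> I" "\<alpha> \<in> sequences"
  shows "coding_map S (case_nat i \<alpha>) = S i (coding_map S \<alpha>)"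
proof -
  have "case_nat i \<alpha> \<in> sequences" using assms by (auto split: nat.split)
  from coding_map_unfold[OF this] show ?thesis by (simp add: shift_def)
qed

text \<open>Limit points do not depend on the starting point, so one may start in \<open>F\<close>. Thus the attractor of a
  system that maps a closed set into itself is contained in this set.\<close>

lemma coding_map_in_closed_invariant:
  assumes F: "closed F" "x \<in> F" and inv: "\<And>i y. i \<in> I \<Longrightarrow> y \<in> F \<Longrightarrow> S i y \<in> F"
    and \<alpha>: "\<alpha> \<in> sequences"
  shows "coding_map S \<alpha> \<in> F"
proof -
  have I: "I \<noteq> {}" using \<alpha> by auto
  have "comp_word S w x \<in> F" if "set w \<subseteq> I" for w
    using that F by (induction w) (auto simp: inv)
  then have inF: "comp_word S (prefix_of \<alpha> k) x \<in> F" for k using set_prefix_of[OF \<alpha>] by blast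
  have "(\<lambda>k. dist (comp_word S (prefix_of \<alpha> k) x) (comp_word S (prefix_of \<alpha> k) 0)) \<longlonglongrightarrow> 0"
  proof (rule tendsto_sandwich[OF _ _ tendsto_const pow_c_tendsto[OF I, of "dist x 0"]])
    show "\<forall>\<^sub>F k in sequentially. dist (comp_word S (prefix_of \<alpha> k) x) (comp_word S (prefix_of \<alpha> k) 0)
            \<le> dist x 0 * c ^ k"
      using ratio_le[OF set_prefix_of[OF \<alpha>]]
      by (simp add: dist_comp_word[OF set_prefix_of[OF \<alpha>]] mult.commute mult_left_mono)
  qed auto
  then have "((\<lambda>k. comp_word S (prefix_of \<alpha> k) x - comp_word S (prefix_of \<alpha> k) 0) \<longlonglongrightarrow> 0)"
    unfolding dist_norm by (rule tendsto_norm_zero_cancel)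
  from Lim_transform[OF coding_limit[OF \<alpha>] this]
  have "(\<lambda>k. comp_word S (prefix_of \<alpha> k) x) \<longlonglongrightarrow> coding_map S \<alpha>" .
  then show ?thesis by - (rule closed_sequentially[OF F(1)], rule inF)
qed

end

section \<open>Self-similar sets with equal ratios\<close>

text \<open>Numbers in the unit interval with the same first \<open>k\<close> digits in base \<open>m\<close> lie in the same \<open>m\<close>-adic
  interval of length \<open>1 / m ^ k\<close>.\<close>

lemma digits_determine_floor:
  fixes m :: nat and t u :: real
  assumes m: "0 < m" and "t \<in> {0..<1}" "u \<in> {0..<1}"
    and "\<And>i. i < k \<Longrightarrow> \<lfloor>real m ^ Suc i * t\<rfloor> mod int m = \<lfloor>real m ^ Suc i * u\<rfloor> mod int m"
  shows "\<lfloor>real m ^ k * t\<rfloor> = \<lfloor>real m ^ k * u\<rfloor>"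
  using assms(4)
proof (induction k)
  case 0
  then show ?case using assms(2,3) floor_eq_iff[of t 0] floor_eq_iff[of u 0] by simp
next
  case (Suc k)
  have div: "\<lfloor>real m ^ Suc k * x\<rfloor> div int m = \<lfloor>real m ^ k * x\<rfloor>" for x
  proof -
    have "\<lfloor>real m ^ Suc k * x / real m\<rfloor> = \<lfloor>real m ^ Suc k * x\<rfloor> div int m"
      by (rule floor_divide_real_eq_div[of "int m", simplified])
    then show ?thesis using m by simp
  qed
  have "\<lfloor>real m ^ Suc k * t\<rfloor> = \<lfloor>real m ^ Suc k * t\<rfloor> div int m * int m + \<lfloor>real m ^ Suc k * t\<rfloor> mod int m"
    by (rule div_mult_mod_eq[symmetric])
  also have "\<dots> = \<lfloor>real m ^ Suc k * u\<rfloor> div int m * int m + \<lfloor>real m ^ Suc k * u\<rfloor> mod int m"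
    unfolding div using Suc by simp
  also have "\<dots> = \<lfloor>real m ^ Suc k * u\<rfloor>" by (rule div_mult_mod_eq)
  finally show ?case .
qed

lemma compact_family_gap:
  fixes G :: "'i \<Rightarrow> 'a::euclidean_space set"
  assumes "finite I" "\<And>i. i \<in> I \<Longrightarrow> compact (G i)" "disjoint_family_on G I"
  shows "\<exists>d>0. \<forall>i\<in>I. \<forall>i'\<in>I. i \<noteq> i' \<longrightarrow> (\<forall>x\<in>G i. \<forall>y\<in>G i'. d \<le> dist x y)"
proof -
  have "\<forall>\<^sub>F d in at_right 0. i \<noteq> i' \<longrightarrow> (\<forall>x\<in>G i. \<forall>y\<in>G i'. d \<le> dist x y)" if ii: "i \<in> I" "i' \<in> I" for i i'
  proof (cases "i = i'")
    case False
    then have "G i \<inter> G i' = {}" using assms(3) ii by (auto simp: disjoint_family_on_def)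
    then obtain d where "d > 0" "\<forall>x\<in>G i. \<forall>y\<in>G i'. d \<le> dist x y"
      using separate_compact_closed[of "G i" "G i'"] assms(2) ii compact_imp_closed by meson
    then show ?thesis
      by (auto intro!: exI[of _ d] simp: eventually_at_right_field) fastforce
  qed auto
  then have "\<forall>\<^sub>F d in at_right (0::real). 0 < d \<and> (\<forall>i\<in>I. \<forall>i'\<in>I. i \<noteq> i' \<longrightarrow> (\<forall>x\<in>G i. \<forall>y\<in>G i'. d \<le> dist x y))"
    using assms(1) by (intro eventually_conj eventually_ball_finite ballI eventually_at_right_less)
  then show ?thesis by (rule eventually_happens'[rotated]) simp
qed

text \<open>The attractor consists of all limit points, and the separation is inherited from the ball. For the
  dimension, the digits of a number in base \<open>m\<close> are used as the code of a point. If two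
  codes first differ at position \<open>k\<close>, the numbers are at distance at most \<open>1 / m ^ k\<close>, whereas the
  points are at distance at least \<open>\<rho> ^ k\<close> times the gap between the images of the ball; the
  condition on \<open>s\<close> compares the two.\<close>

lemma equal_ratio_attractor:
  fixes S :: "nat \<Rightarrow> 'a::euclidean_space \<Rightarrow> 'a" and m :: nat and \<rho> R s :: real
  assumes m: "1 \<le> m" and \<rho>: "0 < \<rho>" "\<rho> < 1" and R: "0 < R"
    and sim: "\<And>i x y. i \<in> {1..m} \<Longrightarrow> dist (S i x) (S i y) = \<rho> * dist x y"
    and ball: "\<And>i x. i \<in> {1..m} \<Longrightarrow> norm x \<le> R \<Longrightarrow> norm (S i x) \<le> R"
    and disj: "disjoint_family_on (\<lambda>i. S i ` cball 0 R) {1..m}"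
    and F: "closed F" "F \<noteq> {}" "\<And>i y. i \<in> {1..m} \<Longrightarrow> y \<in> F \<Longrightarrow> S i y \<in> F"
    and s: "1 \<le> real m * \<rho> powr s"
  shows "\<exists>K. is_attractor m S K \<and> strong_separation m S K \<and> K \<subseteq> F \<and> ereal s \<le> hausdorff_dim K"
proof -
  interpret contracting_similarities "{1..m}" S "\<lambda>_. \<rho>" \<rho> R
    using assms by unfold_locales auto
  have ratio_eq: "ratio w = \<rho> ^ length w" for w by (induction w) auto
  define K where "K = coding_map S ` sequences"
  have seq_ne: "(\<lambda>_. 1) \<in> sequences" using m by auto
  have K_ball: "K \<subseteq> cball 0 R" using coding_map_ball by (auto simp: K_def)
  have "compact K" unfolding K_def
by (rule compact_continuous_image[OF continuous_coding_map compact_sequences])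
  moreover have "K = (\<Union>i\<in>{1..m}. S i ` K)"
  proof (intro equalityI subsetI)
    fix x assume "x \<in> K"
    then obtain \<alpha> where \<alpha>: "\<alpha> \<in> sequences" "x = coding_map S \<alpha>" by (auto simp: K_def)
    have "coding_map S (shift 1 \<alpha>) \<in> K"
      unfolding K_def by (rule imageI[OF shift_sequences[OF \<alpha>(1)]])
    then have "x \<in> S (\<alpha> 0) ` K" unfolding \<alpha>(2) coding_map_unfold[OF \<alpha>(1)] by (rule imageI)
    then show "x \<in> (\<Union>i\<in>{1..m}. S i ` K)" using \<alpha>(1) by blast
  next
    fix x assume "x \<in> (\<Union>i\<in>{1..m}. S i ` K)"
    then obtain i \<alpha> where i: "i \<in> {1..m}" "\<alpha> \<in> sequences" "x = S i (coding_map S \<alpha>)"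
      by (auto simp: K_def)
    then have "case_nat i \<alpha> \<in> sequences" by (auto split: nat.split)
    then show "x \<in> K" unfolding K_def i(3) coding_map_Cons[OF i(1,2), symmetric] by (rule imageI)
  qed
  ultimately have att: "is_attractor m S K"
    using seq_ne unfolding is_attractor_def by (auto simp only: K_def)
  have "strong_separation m S K"
    unfolding strong_separation_def using disj by (rule disjoint_family_on_bisimulation) (use K_ball in blast)
  moreover have "K \<subseteq> F"
  proof -
    obtain x where "x \<in> F" using F(2) by auto
    show ?thesis
      unfolding K_def by (rule image_subsetI) (rule coding_map_in_closed_invariant[OF F(1) \<open>x \<in> F\<close> F(3)])
  qed
  moreover have "ereal s \<le> hausdorff_dim K"
  proof (cases "s \<le> 0")
    case True
    then show ?thesis using hausdorff_dim_nonneg[of K] by (simp add: order_trans[of _ 0])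
  next
    case False
    \<comment> \<open>for a positive exponent a single map would violate the condition, so there is a gap to speak of\<close>
    have "\<rho> powr s < 1" using False \<rho> powr_less_mono'[of \<rho> 0 s] by simp
    with s m have m2: "2 \<le> m" by (cases "m = 1") auto
    have "compact (S i ` cball 0 R)" if "i \<in> {1..m}" for i
      using continuous_comp_word[of "[i]"] that by (intro compact_continuous_image) auto
    then have "\<exists>d>0. \<forall>i\<in>{1..m}. \<forall>i'\<in>{1..m}. i \<noteq> i' \<longrightarrow> (\<forall>x\<in>S i ` cball 0 R. \<forall>y\<in>S i' ` cball 0 R. d \<le> dist x y)"
      by (rule compact_family_gap[OF fin _ disj])
    then obtain d where d: "0 < d" "\<forall>i\<in>{1..m}. \<forall>i'\<in>{1..m}. i \<noteq> i' \<longrightarrow> (\<forall>x\<in>S i ` cball 0 R. \<forall>y\<in>S i' ` cball 0 R. d \<le> dist x y)"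
      by (elim exE conjE)
    \<comment> \<open>the symbols are 1, ..., m, hence the shift of the digits by one\<close>
    define dig where "dig = (\<lambda>(t::real) i. 1 + nat (\<lfloor>real m ^ Suc i * t\<rfloor> mod int m))"
    have dig: "dig t \<in> sequences" for t
    proof -
      have "nat (z mod int m) < m" for z using m by (simp add: nat_less_iff)
      then show ?thesis by (auto simp: dig_def Suc_le_eq)
    qed
    have agree: "\<bar>t - u\<bar> \<le> 1 / real m ^ k"
      if "t \<in> {0..<1}" "u \<in> {0..<1}" "\<And>i. i < k \<Longrightarrow> dig t i = dig u i" for t u k
    proof -
      have "\<lfloor>real m ^ k * t\<rfloor> = \<lfloor>real m ^ k * u\<rfloor>"
      proof (rule digits_determine_floor)
        fix i assume "i < k"
        with that(3)[of i] m show "\<lfloor>real m ^ Suc i * t\<rfloor> mod int m = \<lfloor>real m ^ Suc i * u\<rfloor> mod int m"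
          unfolding dig_def by (simp add: eq_nat_nat_iff)
      qed (use that m in auto)
      then have "\<bar>real m ^ k * t - real m ^ k * u\<bar> \<le> 1" by linarith
      then have "real m ^ k * \<bar>t - u\<bar> \<le> 1"
        by (simp add: abs_mult right_diff_distrib[symmetric])
      then show ?thesis using m by (simp add: field_simps)
    qed
    have "\<bar>t - u\<bar> \<le> d powr (- s) * dist (coding_map S (dig t)) (coding_map S (dig u)) powr s"
      if tu: "t \<in> {0..<1}" "u \<in> {0..<1}" for t u
    proof (cases "t = u")
      case False
      have "\<exists>i. dig t i \<noteq> dig u i"
      proof (rule ccontr)
        assume "\<nexists>i. dig t i \<noteq> dig u i"
        then have *: "\<bar>t - u\<bar> \<le> (1 / real m) ^ k" for k
          using agree[OF tu, of k] by (simp add: power_one_over)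
        obtain k where "(1 / real m) ^ k < \<bar>t - u\<bar>"
          using real_arch_pow_inv[of "\<bar>t - u\<bar>" "1 / real m"] False m2 by auto
        with *[of k] show False by simp
      qed
      define k where "k = (LEAST i. dig t i \<noteq> dig u i)"
      have k: "dig t k \<noteq> dig u k" "\<And>i. i < k \<Longrightarrow> dig t i = dig u i"
        using LeastI_ex[OF \<open>\<exists>i. dig t i \<noteq> dig u i\<close>] not_less_Least unfolding k_def by blast+
      have in_piece: "coding_map S (shift k (dig t)) \<in> S (dig t k) ` cball 0 R" for t
        unfolding coding_map_unfold[OF shift_sequences[OF dig]]
        using coding_map_ball[OF shift_sequences[OF shift_sequences[OF dig]]]
        by (simp add: shift_simps)
      have pre: "prefix_of (dig t) k = prefix_of (dig u) k" using k(2) by (simp add: prefix_of_def)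
      have "dist (coding_map S (dig t)) (coding_map S (dig u))
          = \<rho> ^ k * dist (coding_map S (shift k (dig t))) (coding_map S (shift k (dig u)))"
        using dist_coding_map[OF dig dig pre] by (simp add: ratio_eq)
      also have "\<dots> \<ge> \<rho> ^ k * d"
      proof (rule mult_left_mono)
        have "dig t k \<in> {1..m}" "dig u k \<in> {1..m}" using dig[of t] dig[of u] by simp_all
        from d(2)[rule_format, OF this k(1) in_piece in_piece]
        show "d \<le> dist (coding_map S (shift k (dig t))) (coding_map S (shift k (dig u)))" .
      qed (use \<rho> in auto)
      finally have dist: "\<rho> ^ k \<le> dist (coding_map S (dig t)) (coding_map S (dig u)) / d"
        using d(1) by (simp add: field_simps)
      have "\<bar>t - u\<bar> \<le> 1 / real m ^ k" using agree[OF tu k(2)] by blast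
      also have "\<dots> = (1 / real m) ^ k" by (simp add: power_one_over)
      also have "\<dots> \<le> (\<rho> powr s) ^ k" using s m by (intro power_mono) (auto simp: field_simps)
      also have "\<dots> = (\<rho> ^ k) powr s" using \<rho> by (simp add: powr_powr powr_realpow[symmetric] mult.commute)
      also have "\<dots> \<le> (dist (coding_map S (dig t)) (coding_map S (dig u)) / d) powr s"
        using dist \<rho> False \<open>\<not> s \<le> 0\<close> by (intro powr_mono2) auto
      also have "\<dots> = d powr (- s) * dist (coding_map S (dig t)) (coding_map S (dig u)) powr s"
        using d(1) by (simp add: powr_divide powr_minus field_simps)
      finally show ?thesis .
    qed auto
    then show ?thesis
      using False d(1) dig
      by (intro hausdorff_dim_ge_of_interval_parametrisation[of "\<lambda>t. coding_map S (dig t)" K "d powr (- s)"])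
        (auto simp: K_def)
  qed
  ultimately show ?thesis using att by blast
qed

section \<open>Plane orthogonal matrices as complex numbers\<close>

text \<open>The matrix of \<open>x \<mapsto> z x\<close>, and below that of \<open>x \<mapsto> z cnj x\<close>, on the complex plane. For \<open>z\<close> on the unit
  circle these are the rotations and the reflections.\<close>

definition rot :: "complex \<Rightarrow> real^2^2" where
  "rot z = vector [vector [Re z, - Im z], vector [Im z, Re z]]"

definition mirror :: "complex \<Rightarrow> real^2^2" where
  "mirror z = vector [vector [Re z, Im z], vector [Im z, - Re z]]"

lemma rot_nth: "rot z $ 1 $ 1 = Re z" "rot z $ 1 $ 2 = - Im z" "rot z $ 2 $ 1 = Im z" "rot z $ 2 $ 2 = Re z"
  and mirror_nth: "mirror z $ 1 $ 1 = Re z" "mirror z $ 1 $ 2 = Im z" "mirror z $ 2 $ 1 = Im z" "mirror z $ 2 $ 2 = - Re z"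
  by (simp_all add: rot_def mirror_def)

lemmas mat2_simps = rot_nth mirror_nth vec_eq_iff forall_2 matrix_matrix_mult_def sum_2 transpose_def
  mat_def det_2

lemma rot_mirror_mult:
  "rot z ** rot w = rot (z * w)" "rot z ** mirror w = mirror (z * w)"
  "mirror z ** rot w = mirror (z * cnj w)" "mirror z ** mirror w = rot (z * cnj w)"
  by (simp_all add: mat2_simps algebra_simps)

lemma rot_1: "rot 1 = mat 1"
  and transpose_rot: "transpose (rot z) = rot (cnj z)"
  and transpose_mirror: "transpose (mirror z) = mirror z"
  by (simp_all add: mat2_simps)

lemma det_rot: "det (rot z) = (norm z)\<^sup>2"
  and det_mirror: "det (mirror z) = - (norm z)\<^sup>2"
  unfolding cmod_power2 by (simp_all add: mat2_simps power2_eq_square)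

lemma rot_eq_iff: "rot z = rot w \<longleftrightarrow> z = w"
  and mirror_eq_iff: "mirror z = mirror w \<longleftrightarrow> z = w"
  by (auto simp: mat2_simps complex_eq_iff)

lemma orthogonal_rot_mirror: "norm z = 1 \<Longrightarrow> orthogonal_matrix (rot z) \<and> orthogonal_matrix (mirror z)"
  by (simp add: orthogonal_matrix transpose_rot transpose_mirror rot_mirror_mult complex_norm_square[symmetric]
      mult.commute[of "cnj z"] rot_1)

text \<open>The determinant of an orthogonal matrix is \<open>1\<close> or \<open>-1\<close>. In either case one sum of two squares of
  linear expressions in the entries vanishes, which leaves two free entries.\<close>

lemma orthogonal_matrix_2_cases:
  fixes Q :: "real^2^2"
  assumes "orthogonal_matrix Q"
  obtains z where "norm z = 1" "Q = rot z" | z where "norm z = 1" "Q = mirror z"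
proof -
  define a b c d where abcd: "a = Q $ 1 $ 1" "b = Q $ 1 $ 2" "c = Q $ 2 $ 1" "d = Q $ 2 $ 2"
  have eqs: "a * a + c * c = 1" "a * b + c * d = 0" "b * b + d * d = 1"
    using assms by (simp_all add: orthogonal_matrix mat2_simps abcd)
  have "(a * d - b * c)\<^sup>2 = (a * a + c * c) * (b * b + d * d) - (a * b + c * d)\<^sup>2"
    by (simp add: power2_eq_square algebra_simps)
  then have "(a * d - b * c)\<^sup>2 = 1" using eqs by simp
  then have "a * d - b * c = 1 \<or> a * d - b * c = -1" by (simp add: power2_eq_1_iff)
  then show thesis
  proof
    assume det: "a * d - b * c = 1"
    have "(a - d)\<^sup>2 + (b + c)\<^sup>2 = (a * a + c * c) + (b * b + d * d) - 2 * (a * d - b * c)"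
      by (simp add: power2_eq_square algebra_simps)
    then have "(a - d)\<^sup>2 + (b + c)\<^sup>2 = 0" using eqs det by simp
    then have "a = d" "b = - c" by (simp_all add: sum_power2_eq_zero_iff)
    then have "Q = rot (Complex a c)" by (simp add: mat2_simps abcd)
    moreover have "norm (Complex a c) = 1" using eqs by (simp add: cmod_def power2_eq_square)
    ultimately show thesis using that(1) by blast
  next
    assume det: "a * d - b * c = -1"
    have "(a + d)\<^sup>2 + (b - c)\<^sup>2 = (a * a + c * c) + (b * b + d * d) + 2 * (a * d - b * c)"
      by (simp add: power2_eq_square algebra_simps)
    then have "(a + d)\<^sup>2 + (b - c)\<^sup>2 = 0" using eqs det by simp
    then have "d = - a" "b = c" by (simp_all add: sum_power2_eq_zero_iff)
    then have "Q = mirror (Complex a c)" by (simp add: mat2_simps abcd)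
    moreover have "norm (Complex a c) = 1" using eqs by (simp add: cmod_def power2_eq_square)
    ultimately show thesis using that(2) by blast
  qed
qed

lemma rotation_matrix_2_iff: "rotation_matrix Q \<longleftrightarrow> (\<exists>z. norm z = 1 \<and> Q = rot z)"
proof
  assume Q: "rotation_matrix Q"
  then have "orthogonal_matrix Q" "det Q = 1" by (auto simp: rotation_matrix_def)
  from this(1) show "\<exists>z. norm z = 1 \<and> Q = rot z"
    by (cases rule: orthogonal_matrix_2_cases) (use \<open>det Q = 1\<close> in \<open>auto simp: det_mirror\<close>)
next
  assume "\<exists>z. norm z = 1 \<and> Q = rot z"
  then obtain z where "norm z = 1" "Q = rot z" by auto
  then show "rotation_matrix Q" using orthogonal_rot_mirror[of z] by (simp add: rotation_matrix_def det_rot)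
qed

lemma continuous_rot: "continuous_on X rot"
proof -
  have "rot = (\<lambda>z. Re z *\<^sub>R rot 1 + Im z *\<^sub>R rot \<i>)"
    by (rule ext) (simp add: mat2_simps)
  then show ?thesis by (rule ssubst) (intro continuous_intros)
qed

section \<open>Rotations that generate dense subgroups\<close>

text \<open>An infinite order means that the angle is an irrational part of a full turn, so that Kronecker's
  approximation theorem applies.\<close>

lemma powers_dense_in_circle:
  fixes z w :: complex
  assumes z: "norm z = 1" "\<And>n. 0 < n \<Longrightarrow> z ^ n \<noteq> 1" and w: "norm w = 1"
  shows "w \<in> closure (range (\<lambda>n. z ^ n))"
  unfolding closure_approachable
proof (intro allI impI)
  fix e :: real assume "0 < e"
  define \<theta> \<phi> where "\<theta> = Arg z" and "\<phi> = Arg w"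
  have \<theta>: "z = cis \<theta>" and \<phi>: "w = cis \<phi>"
    using rcis_cmod_Arg[of z] rcis_cmod_Arg[of w] z w by (simp_all add: \<theta>_def \<phi>_def rcis_def)
  have irr: "\<theta> / (2 * pi) \<notin> \<rat>"
  proof
    assume "\<theta> / (2 * pi) \<in> \<rat>"
    then obtain a b' :: int where ab': "b' > 0" "\<theta> / (2 * pi) = of_int a / of_int b'"
      by (rule Rats_cases')
    define b where "b = nat b'"
    have ab: "b \<noteq> 0" "\<theta> / (2 * pi) = of_int a / of_nat b" using ab' by (simp_all add: b_def)
    then have "real b * \<theta> = 2 * pi * of_int a" by (simp add: field_simps)
    then have "z ^ b = cis (2 * pi * of_int a)" by (simp only: \<theta> Complex.DeMoivre)
    also have "\<dots> = 1" by simp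
    finally show False using z(2)[of b] ab(1) by simp
  qed
  have "isCont cis \<phi>" using continuous_on_cis[OF continuous_on_id, of UNIV] by (simp add: continuous_on_eq_continuous_at)
  then obtain \<delta> where \<delta>: "0 < \<delta>" "\<And>x. dist x \<phi> < \<delta> \<Longrightarrow> dist (cis x) (cis \<phi>) < e"
    using \<open>0 < e\<close> unfolding continuous_at_eps_delta by (auto simp: dist_norm)
  have "0 < \<delta> / (2 * pi)" using \<delta> by simp
  from sequence_of_fractional_parts_is_dense[OF irr this, of "\<phi> / (2 * pi)"]
  obtain h k :: int where k: "k > 0" "\<bar>of_int k * (\<theta> / (2 * pi)) - of_int h - \<phi> / (2 * pi)\<bar> < \<delta> / (2 * pi)"
    by blast
  have "of_int k * \<theta> - 2 * pi * of_int h - \<phi> = 2 * pi * (of_int k * (\<theta> / (2 * pi)) - of_int h - \<phi> / (2 * pi))"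
    by (simp add: field_simps)
  then have "\<bar>of_int k * \<theta> - 2 * pi * of_int h - \<phi>\<bar> < \<delta>"
    using mult_strict_left_mono[OF k(2), of "2 * pi"] by (simp add: abs_mult)
  then have "dist (cis (of_int k * \<theta> - 2 * pi * of_int h)) w < e"
    using \<delta>(2) \<phi> by (simp add: dist_real_def)
  moreover have "cis (of_int k * \<theta> - 2 * pi * of_int h) = z ^ nat k"
    using k(1) by (simp add: cis_divide[symmetric] \<theta> Complex.DeMoivre)
  ultimately show "\<exists>y\<in>range (\<lambda>n. z ^ n). dist y w < e" by auto
qed

text \<open>As for ideals of the integers: the least positive exponent \<open>d\<close> of a primitive root that occurs in
  \<open>Z\<close> divides all others. A remainder modulo \<open>d\<close> is formed without inverses, which \<open>Z\<close> has only
  implicitly: the inverse of \<open>z\<close> is \<open>z ^ (N - 1)\<close>.\<close>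

lemma roots_of_unity_cyclic:
  fixes Z :: "complex set"
  assumes N: "0 < N" "\<And>z. z \<in> Z \<Longrightarrow> z ^ N = 1" and Z: "1 \<in> Z" "\<And>z w. z \<in> Z \<Longrightarrow> w \<in> Z \<Longrightarrow> z * w \<in> Z"
  shows "\<exists>g\<in>Z. \<forall>z\<in>Z. \<exists>k. z = g ^ k"
proof -
  define \<omega> where "\<omega> = cis (2 * pi / real N)"
  have \<omega>N: "\<omega> ^ N = 1" using N(1) by (simp add: \<omega>_def Complex.DeMoivre)
  have pow: "z ^ k \<in> Z" if "z \<in> Z" for z k using that Z by (induction k) auto
  define d where "d = (LEAST k. 0 < k \<and> \<omega> ^ k \<in> Z)"
  have d: "0 < d" "\<omega> ^ d \<in> Z"
    using LeastI[of "\<lambda>k. 0 < k \<and> \<omega> ^ k \<in> Z" N] N(1) Z(1) \<omega>N by (auto simp: d_def)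
  have "\<exists>k. z = (\<omega> ^ d) ^ k" if z: "z \<in> Z" for z
  proof -
    have "z \<in> (\<lambda>k. cis (2 * pi * real k / real N)) ` {..<N}"
      using Complex.bij_betw_roots_unity[OF N(1)] N(2)[OF z] by (auto simp: bij_betw_def)
    then obtain k where "z = cis (2 * pi * real k / real N)" by auto
    then have k: "z = \<omega> ^ k" by (simp add: \<omega>_def Complex.DeMoivre mult.commute)
    have "\<omega> ^ k * ((\<omega> ^ d) ^ (k div d)) ^ (N - 1) = \<omega> ^ (k mod d) * ((\<omega> ^ d) ^ (k div d)) ^ N"
    proof -
      have "\<omega> ^ k = \<omega> ^ (k mod d) * (\<omega> ^ d) ^ (k div d)"
        by (metis mod_mult_div_eq power_add power_mult)
      then have "\<omega> ^ k * ((\<omega> ^ d) ^ (k div d)) ^ (N - 1)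
          = \<omega> ^ (k mod d) * ((\<omega> ^ d) ^ (k div d) * ((\<omega> ^ d) ^ (k div d)) ^ (N - 1))" by simp
      then show ?thesis using N(1) by (simp add: power_eq_if[of _ N])
    qed
    also have "\<dots> = \<omega> ^ (k mod d)" using N(2)[OF pow[OF d(2)]] by simp
    finally have "\<omega> ^ (k mod d) \<in> Z" using Z(2)[OF z pow[OF pow[OF d(2)]]] k by metis
    moreover have "k mod d < d" using d(1) by simp
    ultimately have "k mod d = 0" using not_less_Least[of "k mod d" "\<lambda>k. 0 < k \<and> \<omega> ^ k \<in> Z"] d_def by auto
    then have "k = d * (k div d)" by auto
    then have "z = (\<omega> ^ d) ^ (k div d)" using k by (metis power_mult)
    then show ?thesis ..
  qed
  then show ?thesis using d(2) by blast
qed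

lemma common_exponent:
  fixes D :: "complex set"
  assumes "finite D" "\<And>z. z \<in> D \<Longrightarrow> \<exists>n>0. z ^ n = 1"
  shows "\<exists>N>0. \<forall>z\<in>D. z ^ N = 1"
  using assms
proof (induction D)
  case empty
  then show ?case by (auto intro: exI[of _ "1::nat"])
next
  case (insert x D)
  then obtain N n where N: "0 < N" "\<forall>z\<in>D. z ^ N = 1" and n: "0 < n" "x ^ n = 1"
    by (meson insertI1 insertI2)
  have "z ^ (N * n) = 1" if "z \<in> insert x D" for z
  proof (cases "z = x")
    case True
    then show ?thesis using n by (simp add: mult.commute[of N] power_mult)
  next
    case False
    then show ?thesis using N that by (simp add: power_mult)
  qed
  then show ?case using N n by (intro exI[of _ "N * n"]) auto
qed

lemma powers_in_generate:
  assumes "norm z = 1"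
  shows "rot (z ^ n) \<in> generate orthogonal_group {rot z}"
proof (induction n)
  case 0
  have "\<one>\<^bsub>orthogonal_group\<^esub> \<in> generate orthogonal_group {rot z}" by (rule generate.one)
  then show ?case by (simp add: orthogonal_group_def rot_1)
next
  case (Suc n)
  have "rot z \<otimes>\<^bsub>orthogonal_group\<^esub> rot (z ^ n) \<in> generate orthogonal_group {rot z}"
    by (rule generate.eng[OF generate.incl Suc]) simp
  then show ?case by (simp add: orthogonal_group_def rot_mirror_mult)
qed

lemma subgroup_rotations: "subgroup {R :: real^2^2. rotation_matrix R} orthogonal_group"
proof -
  interpret group "orthogonal_group :: (real^2^2) monoid" by (rule group_orthogonal_group)
  have inv: "inv\<^bsub>orthogonal_group\<^esub> (rot z) = rot (cnj z)" if "norm z = 1" for z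
    using that orthogonal_rot_mirror[of z] orthogonal_rot_mirror[of "cnj z"]
    by (intro inv_equality)
      (auto simp: orthogonal_group_def rot_mirror_mult rot_1[symmetric] mult.commute[of "cnj z"] complex_norm_square[symmetric])
  show ?thesis
  proof (rule subgroupI)
    show "{R. rotation_matrix R} \<subseteq> carrier (orthogonal_group :: (real^2^2) monoid)"
      by (auto simp: orthogonal_group_def rotation_matrix_def)
    show "{R :: real^2^2. rotation_matrix R} \<noteq> {}"
      using rotation_matrix_2_iff[of "rot 1"] by (auto intro: exI[of _ "1::complex"])
  next
    fix Q :: "real^2^2" assume "Q \<in> {R. rotation_matrix R}"
    then obtain z where "norm z = 1" "Q = rot z" by (auto simp: rotation_matrix_2_iff)
    then show "inv\<^bsub>orthogonal_group\<^esub> Q \<in> {R. rotation_matrix R}"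
      by (auto simp: inv rotation_matrix_2_iff intro!: exI[of _ "cnj z"])
  next
    fix Q Q' :: "real^2^2" assume "Q \<in> {R. rotation_matrix R}" "Q' \<in> {R. rotation_matrix R}"
    then obtain z w where "norm z = 1" "Q = rot z" "norm w = 1" "Q' = rot w"
      by (auto simp: rotation_matrix_2_iff)
    then show "Q \<otimes>\<^bsub>orthogonal_group\<^esub> Q' \<in> {R. rotation_matrix R}"
      by (auto simp: orthogonal_group_def rot_mirror_mult rotation_matrix_2_iff norm_mult intro!: exI[of _ "z * w"])
  qed
qed

lemma generate_rot_subset:
  assumes "norm z = 1" "rot z \<in> generate orthogonal_group P" "P \<subseteq> {Q. orthogonal_matrix Q}"
  shows "generate orthogonal_group {rot z} \<subseteq> generate orthogonal_group P \<inter> {R. rotation_matrix R}"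
proof -
  interpret group "orthogonal_group :: (real^2^2) monoid" by (rule group_orthogonal_group)
  have "subgroup (generate orthogonal_group P) orthogonal_group"
    using assms(3) by (intro generate_is_subgroup) (auto simp: orthogonal_group_def)
  moreover have "rotation_matrix (rot z)" using assms(1) by (auto simp: rotation_matrix_2_iff)
  ultimately show ?thesis
    using generate_subgroup_incl[of "{rot z}"] subgroup_rotations assms(2) by auto
qed

lemma dense_of_infinite_order:
  assumes "norm z = 1" "\<And>n. 0 < n \<Longrightarrow> z ^ n \<noteq> 1"
    and "rot z \<in> generate orthogonal_group P" "P \<subseteq> {Q. orthogonal_matrix Q}"
  shows "dense_subset (generate orthogonal_group {rot z})
           (generate orthogonal_group P \<inter> {R. rotation_matrix R})"
  unfolding dense_subset_def
proof
  show "generate orthogonal_group {rot z} \<subseteq> generate orthogonal_group P \<inter> {R. rotation_matrix R}"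
    by (rule generate_rot_subset[OF assms(1,3,4)])
  show "generate orthogonal_group P \<inter> {R. rotation_matrix R} \<subseteq> closure (generate orthogonal_group {rot z})"
  proof
    fix Q assume "Q \<in> generate orthogonal_group P \<inter> {R. rotation_matrix R}"
    then obtain w where w: "norm w = 1" "Q = rot w" by (auto simp: rotation_matrix_2_iff)
    have "rot ` closure (range (\<lambda>n. z ^ n)) \<subseteq> closure (rot ` range (\<lambda>n. z ^ n))"
      by (rule image_closure_subset[OF continuous_rot closed_closure closure_subset])
    also have "\<dots> \<subseteq> closure (generate orthogonal_group {rot z})"
      using powers_in_generate[OF assms(1)] by (intro closure_mono) auto
    finally show "Q \<in> closure (generate orthogonal_group {rot z})"
      using powers_dense_in_circle[OF assms(1,2) w(1)] w(2) by auto
  qed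
qed

text \<open>Let \<open>s\<close> be such that \<open>mirror s\<close> is one of the generators, if there is a reflection among them.
  Every other reflection in \<open>E\<close> is then a rotation from \<open>P\<close>, hence of finite order, times
  \<open>mirror s\<close>. With a common exponent \<open>N\<close> of these finitely many rotations, all generators lie in
  the dihedral group of the rotations by \<open>N\<close>-th roots of unity and their products with \<open>mirror s\<close>,
  and so does \<open>P\<close>.\<close>

lemma finite_exponent_of_finitely_generated:
  fixes P E :: "(real^2^2) set"
  assumes P: "P \<subseteq> {Q. orthogonal_matrix Q}" "\<And>X Y. X \<in> P \<Longrightarrow> Y \<in> P \<Longrightarrow> X ** Y \<in> P"
    and torsion: "\<And>z. norm z = 1 \<Longrightarrow> rot z \<in> P \<Longrightarrow> \<exists>n>0. z ^ n = 1"
    and E: "finite E" "E \<subseteq> P"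
    and gen: "\<And>C. mat 1 \<in> C \<Longrightarrow> (\<And>X Y. X \<in> C \<Longrightarrow> Y \<in> C \<Longrightarrow> X ** Y \<in> C) \<Longrightarrow> E \<subseteq> C \<Longrightarrow> P \<subseteq> C"
  shows "\<exists>N>0. \<forall>z. norm z = 1 \<longrightarrow> rot z \<in> P \<longrightarrow> z ^ N = 1"
proof -
  obtain s where s: "norm s = 1" "\<And>e. norm e = 1 \<Longrightarrow> mirror e \<in> E \<Longrightarrow> mirror s \<in> E"
    by (metis norm_one)
  define D where "D = {z. norm z = 1 \<and> rot z \<in> E} \<union> (\<lambda>e. e * cnj s) ` {e. norm e = 1 \<and> mirror e \<in> E}"
  have "finite (rot -` E)" "finite (mirror -` E)"
    using E(1) by (auto intro!: finite_vimageI simp: inj_on_def rot_eq_iff mirror_eq_iff)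
  moreover have "{z. norm z = 1 \<and> rot z \<in> E} \<subseteq> rot -` E" "{e. norm e = 1 \<and> mirror e \<in> E} \<subseteq> mirror -` E"
    by auto
  ultimately have "finite {z. norm z = 1 \<and> rot z \<in> E}" "finite {e. norm e = 1 \<and> mirror e \<in> E}"
    by (metis finite_subset)+
  then have "finite D" unfolding D_def by (intro finite_UnI finite_imageI)
  moreover have "\<exists>n>0. z ^ n = 1" if "z \<in> D" for z
  proof (rule torsion)
    show "norm z = 1" using that s(1) by (auto simp: D_def norm_mult)
    show "rot z \<in> P"
      using that
    proof (unfold D_def, elim UnE)
      assume "z \<in> (\<lambda>e. e * cnj s) ` {e. norm e = 1 \<and> mirror e \<in> E}"
      then obtain e where e: "z = e * cnj s" "norm e = 1" "mirror e \<in> E" by auto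
      then have "mirror e ** mirror s \<in> P" using s(2) E(2) P(2) by blast
      then show ?thesis by (simp add: e rot_mirror_mult)
    qed (use E(2) in auto)
  qed
  ultimately obtain N where N: "0 < N" "\<forall>z\<in>D. z ^ N = 1" using common_exponent by meson
  define C where "C = rot ` {z. z ^ N = 1} \<union> (\<lambda>z. mirror (s * z)) ` {z. z ^ N = 1}"
  have cnj1: "cnj z ^ N = 1" if "z ^ N = 1" for z using that by (metis complex_cnj_one complex_cnj_power)
  have ss: "s * cnj s = 1" using s(1) by (simp add: complex_norm_square[symmetric])
  have "P \<subseteq> C"
  proof (rule gen)
    show "mat 1 \<in> C" using rot_1 by (auto simp: C_def intro!: image_eqI[of _ _ 1])
  next
    fix X Y assume "X \<in> C" "Y \<in> C"
    then obtain z w where zw: "z ^ N = 1" "w ^ N = 1" and X: "X = rot z \<or> X = mirror (s * z)" and Y: "Y = rot w \<or> Y = mirror (s * w)"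
      by (auto simp: C_def)
    have "rot z ** rot w = rot (z * w)" "rot z ** mirror (s * w) = mirror (s * (z * w))"
      "mirror (s * z) ** rot w = mirror (s * (z * cnj w))"
      by (simp_all add: rot_mirror_mult mult_ac)
    moreover have "mirror (s * z) ** mirror (s * w) = rot ((s * cnj s) * (z * cnj w))"
      by (simp add: rot_mirror_mult mult_ac)
    moreover have "(z * w) ^ N = 1" "(z * cnj w) ^ N = 1"
      using zw cnj1 by (simp_all add: power_mult_distrib)
    ultimately show "X ** Y \<in> C" using X Y unfolding C_def ss by auto
  next
    show "E \<subseteq> C"
    proof
      fix X assume X: "X \<in> E"
      then have "orthogonal_matrix X" using E(2) P(1) by auto
      then show "X \<in> C"
      proof (cases rule: orthogonal_matrix_2_cases)
        case (1 z)
        then have "z \<in> D" using X by (auto simp: D_def)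
        then show ?thesis using N(2) 1 by (auto simp: C_def)
      next
        case (2 e)
        then have "e * cnj s \<in> D" using X by (auto simp: D_def)
        then have "(e * cnj s) ^ N = 1" using N(2) by blast
        moreover have "s * (e * cnj s) = e" using ss by (simp add: mult_ac)
        then have "X = mirror (s * (e * cnj s))" using 2(2) by (simp only:)
        ultimately show ?thesis unfolding C_def by blast
      qed
    qed
  qed
  have "z ^ N = 1" if z: "norm z = 1" "rot z \<in> P" for z
  proof -
    have "rot z \<in> C" using z \<open>P \<subseteq> C\<close> by auto
    moreover have "rot z \<noteq> mirror w" for w
    proof
      assume "rot z = mirror w"
      then have "(norm z)\<^sup>2 = - (norm w)\<^sup>2" using det_rot[of z] det_mirror[of w] by simp
      then show False using z(1) zero_le_power2[of "norm w"] by simp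
    qed
    ultimately show ?thesis by (auto simp: C_def rot_eq_iff)
  qed
  then show ?thesis using N(1) by blast
qed

text \<open>Inverses are positive powers: reflections are involutions, and rotations have finite order.\<close>

lemma group_of_torsion_semigroup:
  fixes P :: "(real^2^2) set"
  assumes P: "P \<subseteq> {Q. orthogonal_matrix Q}" "\<And>X Y. X \<in> P \<Longrightarrow> Y \<in> P \<Longrightarrow> X ** Y \<in> P" "P \<noteq> {}"
    and torsion: "\<And>z. norm z = 1 \<Longrightarrow> rot z \<in> P \<Longrightarrow> \<exists>n>0. z ^ n = 1"
  shows "generate orthogonal_group P = P"
proof -
  interpret group "orthogonal_group :: (real^2^2) monoid" by (rule group_orthogonal_group)
  have pow: "rot (z ^ Suc n) \<in> P" if "rot z \<in> P" for z n
    using that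
  proof (induction n)
    case (Suc n)
    then show ?case using P(2)[of "rot z" "rot (z ^ Suc n)"] by (simp add: rot_mirror_mult)
  qed simp
  have inv: "inv\<^bsub>orthogonal_group\<^esub> X \<in> P" if X: "X \<in> P" for X
  proof -
    have ort: "orthogonal_matrix X" using X P(1) by auto
    then show ?thesis
    proof (cases rule: orthogonal_matrix_2_cases)
      case (1 z)
      obtain n where n: "0 < n" "z ^ n = 1" using torsion[of z] 1 X by auto
      \<comment> \<open>the exponent n - 1 would do, but it may be 0, and a semigroup has no empty power\<close>
      have "z ^ Suc (2 * n - 2) * z = (z ^ n)\<^sup>2"
      proof -
        have "Suc (Suc (2 * n - 2)) = n * 2" using n(1) by simp
        then show ?thesis by (simp only: power_mult[symmetric] power_Suc2[symmetric])
      qed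
      then have "inv\<^bsub>orthogonal_group\<^esub> X = rot (z ^ Suc (2 * n - 2))"
        using 1 ort orthogonal_rot_mirror[of "z ^ Suc (2 * n - 2)"] n(2)
        by (intro inv_equality) (auto simp: orthogonal_group_def rot_mirror_mult rot_1 norm_power norm_mult)
      then show ?thesis using pow[of z "2 * n - 2"] X 1 by simp
    next
      case (2 z)
      then have "inv\<^bsub>orthogonal_group\<^esub> X = X"
        using ort by (intro inv_equality)
          (auto simp: orthogonal_group_def rot_mirror_mult rot_1 complex_norm_square[symmetric])
      then show ?thesis using X by simp
    qed
  qed
  have "subgroup P orthogonal_group"
    using P inv by (intro subgroupI) (auto simp: orthogonal_group_def)
  then show ?thesis
    using generate_subgroup_incl[of P P] generate.incl[of _ P] by blast
qed

text \<open>If \<open>z0\<close> has infinite order, one further factor \<open>z0\<close> does no harm. If \<open>z0\<close> has finite order, the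
  powers \<open>L\<close> are taken to be multiples of this order, so that only \<open>p\<close> matters: it may be any rotation of
  infinite order in \<open>P\<close>, or, if there is none, a generator of the cyclic group of all rotations in
  \<open>P\<close>. The assumption \<open>gen\<close> says that \<open>E\<close> generates \<open>P\<close> as a monoid; without finite generation, the
  torsion case fails, as the group of all roots of unity is not cyclic.\<close>

lemma exists_dense_rotation:
  fixes P E :: "(real^2^2) set"
  assumes P: "P \<subseteq> {Q. orthogonal_matrix Q}" "\<And>X Y. X \<in> P \<Longrightarrow> Y \<in> P \<Longrightarrow> X ** Y \<in> P"
    and z0: "norm z0 = 1" "rot z0 \<in> P"
    and E: "finite E" "E \<subseteq> generate orthogonal_group P"
    and gen: "\<And>C. mat 1 \<in> C \<Longrightarrow> (\<And>X Y. X \<in> C \<Longrightarrow> Y \<in> C \<Longrightarrow> X ** Y \<in> C) \<Longrightarrow> E \<subseteq> C \<Longrightarrow> P \<subseteq> C"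
  shows "\<exists>p. norm p = 1 \<and> rot p \<in> P \<and> (\<forall>L0::nat. \<exists>L\<ge>L0.
           dense_subset (generate orthogonal_group {rot (z0 ^ L * p)})
             (generate orthogonal_group P \<inter> {R. rotation_matrix R}))"
proof (cases "\<exists>n>0. z0 ^ n = 1")
  case False
  have "dense_subset (generate orthogonal_group {rot (z0 ^ L * z0)})
             (generate orthogonal_group P \<inter> {R. rotation_matrix R})" for L
  proof (rule dense_of_infinite_order)
    show "norm (z0 ^ L * z0) = 1" using z0 by (simp add: norm_mult norm_power)
    show "(z0 ^ L * z0) ^ n \<noteq> 1" if "0 < n" for n
    proof -
      have "(z0 ^ L * z0) ^ n = z0 ^ (Suc L * n)" by (simp only: power_mult power_Suc2)
      moreover have "0 < Suc L * n" using that by simp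
      ultimately show ?thesis using False by (simp only:) blast
    qed
    have "rot (z0 ^ L * z0) \<in> P"
    proof (induction L)
      case (Suc L)
      then show ?case using P(2)[OF z0(2) Suc] by (simp add: rot_mirror_mult mult_ac)
    qed (use z0 in simp)
    then show "rot (z0 ^ L * z0) \<in> generate orthogonal_group P" by (rule generate.incl)
  qed (rule P(1))
  then show ?thesis using z0 by blast
next
  case True
  then obtain N0 where N0: "0 < N0" "z0 ^ N0 = 1" by auto
  show ?thesis
  proof (cases "\<exists>z. norm z = 1 \<and> rot z \<in> P \<and> (\<forall>n>0. z ^ n \<noteq> 1)")
    case True
    then obtain p where p: "norm p = 1" "rot p \<in> P" "\<And>n. 0 < n \<Longrightarrow> p ^ n \<noteq> 1" by auto
    have "\<exists>L\<ge>L0. dense_subset (generate orthogonal_group {rot (z0 ^ L * p)})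
             (generate orthogonal_group P \<inter> {R. rotation_matrix R})" for L0
      using N0 dense_of_infinite_order[OF p(1,3) generate.incl[OF p(2)] P(1)]
      by (intro exI[of _ "N0 * L0"]) (simp add: power_mult)
    then show ?thesis using p by blast
  next
    case False
    then have torsion: "\<exists>n>0. z ^ n = 1" if "norm z = 1" "rot z \<in> P" for z using that by auto
    have G: "generate orthogonal_group P = P"
      by (rule group_of_torsion_semigroup[OF P _ torsion]) (use z0 in auto)
    obtain N where N: "0 < N" "\<And>z. norm z = 1 \<Longrightarrow> rot z \<in> P \<Longrightarrow> z ^ N = 1"
      using finite_exponent_of_finitely_generated[OF P torsion E(1) E(2)[unfolded G] gen] by blast
    define Z where "Z = {z. norm z = 1 \<and> rot z \<in> P}"
    have "\<exists>g\<in>Z. \<forall>z\<in>Z. \<exists>k. z = g ^ k"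
    proof (rule roots_of_unity_cyclic[OF N(1)])
      show "z * w \<in> Z" if "z \<in> Z" "w \<in> Z" for z w
        using that P(2)[of "rot z" "rot w"] by (auto simp: Z_def norm_mult rot_mirror_mult)
      have "mat 1 \<in> generate orthogonal_group P"
        using generate.one[of orthogonal_group P] by (simp add: orthogonal_group_def)
      then show "1 \<in> Z" by (simp add: Z_def rot_1 G)
    qed (auto simp: Z_def N(2))
    then obtain g where g: "norm g = 1" "rot g \<in> P" "\<And>z. z \<in> Z \<Longrightarrow> \<exists>k. z = g ^ k" by (auto simp: Z_def)
    have "P \<inter> {R. rotation_matrix R} \<subseteq> generate orthogonal_group {rot g}"
    proof
      fix Q assume "Q \<in> P \<inter> {R. rotation_matrix R}"
      then obtain z where "z \<in> Z" "Q = rot z" by (auto simp: rotation_matrix_2_iff Z_def)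
      then show "Q \<in> generate orthogonal_group {rot g}"
        using g(3)[of z] powers_in_generate[OF g(1)] by auto
    qed
    then have "dense_subset (generate orthogonal_group {rot g}) (generate orthogonal_group P \<inter> {R. rotation_matrix R})"
      using generate_rot_subset[OF g(1) generate.incl[OF g(2)] P(1)] closure_subset
      unfolding dense_subset_def G by blast
    then have "\<exists>L\<ge>L0. dense_subset (generate orthogonal_group {rot (z0 ^ L * g)})
             (generate orthogonal_group P \<inter> {R. rotation_matrix R})" for L0
      using N0 by (intro exI[of _ "N0 * L0"]) (simp add: power_mult)
    then show ?thesis using g by blast
  qed
qed

section \<open>Loops in the transition graph\<close>

text \<open>A walk visits the letters of the word, starting at \<open>a\<close>, and then steps to \<open>b\<close>, which is not part of
  the word. In this way walks are composed by appending words, and the empty word is a walk from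
  each letter to itself.\<close>

fun walk :: "nat \<Rightarrow> nat mat \<Rightarrow> nat \<Rightarrow> nat list \<Rightarrow> nat \<Rightarrow> bool" where
  "walk M A a [] b \<longleftrightarrow> a = b"
| "walk M A a (x # w) b \<longleftrightarrow> x = a \<and> a < M \<and> (\<exists>c<M. A $$ (a, c) = 1 \<and> walk M A c w b)"

lemma walk_append: "walk M A a u b \<Longrightarrow> walk M A b w c \<Longrightarrow> walk M A a (u @ w) c"
  by (induction u arbitrary: a) auto

lemma walk_alphabet: "walk M A a w b \<Longrightarrow> set w \<subseteq> {..<M}"
  by (induction w arbitrary: a) auto

lemma walk_nonempty_iff:
  assumes "b < M" "w \<noteq> []"
  shows "walk M A a w b \<longleftrightarrow> set w \<subseteq> {..<M} \<and> hd w = a \<and>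
     (\<forall>i. Suc i < length w \<longrightarrow> A $$ (w ! i, w ! Suc i) = 1) \<and> A $$ (last w, b) = 1"
  using assms(2)
proof (induction w arbitrary: a)
  case (Cons x w)
  show ?case
  proof (cases "w = []")
    case True
    then show ?thesis using assms(1) by auto
  next
    case False
    have "(\<forall>i. Suc i < length (x # w) \<longrightarrow> A $$ ((x # w) ! i, (x # w) ! Suc i) = 1) \<longleftrightarrow>
        A $$ (x, hd w) = 1 \<and> (\<forall>i. Suc i < length w \<longrightarrow> A $$ (w ! i, w ! Suc i) = 1)"
      using False by (auto simp: nth_Cons hd_conv_nth split: nat.splits) 
    moreover have "hd w < M" if "set w \<subseteq> {..<M}" using False that by (auto simp: hd_in_set subset_iff)
    ultimately show ?thesis using Cons.IH[OF False] False by auto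
  qed
qed simp

lemma loops_at_eq: "j < M \<Longrightarrow> loops_at M A j = {w. w \<noteq> [] \<and> walk M A j w j}"
  unfolding loops_at_def by (rule Collect_cong) (metis walk_nonempty_iff)

lemma exists_walk_of_pow_pos:
  assumes A: "zero_one_matrix M A" and "a < M" "b < M" "(A ^\<^sub>m n) $$ (a, b) > 0"
  shows "\<exists>w. length w = n \<and> walk M A a w b"
  using assms(3,4)
proof (induction n arbitrary: b)
  case 0
  then show ?case using A assms(2) by (auto simp: zero_one_matrix_def split: if_split_asm)
next
  case (Suc n)
  have carrier: "A \<in> carrier_mat M M" using A by (simp add: zero_one_matrix_def)
  have dims [simp]: "dim_row A = M" "dim_col A = M" "dim_row (A ^\<^sub>m n) = M" "dim_col (A ^\<^sub>m n) = M"
    using carrier_matD[OF carrier] carrier_matD[OF pow_carrier_mat[OF carrier, of n]] by blast+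
  have "(A ^\<^sub>m Suc n) $$ (a, b) = (\<Sum>c\<in>{0..<M}. (A ^\<^sub>m n) $$ (a, c) * A $$ (c, b))"
    using Suc.prems assms(2) by (simp add: scalar_prod_def)
  with Suc.prems have "(\<Sum>c\<in>{0..<M}. (A ^\<^sub>m n) $$ (a, c) * A $$ (c, b)) \<noteq> 0" by linarith
  then obtain c where c: "c < M" "(A ^\<^sub>m n) $$ (a, c) * A $$ (c, b) \<noteq> 0"
    by (rule sum.not_neutral_contains_not_neutral) simp
  then obtain w where w: "length w = n" "walk M A a w c" using Suc.IH[OF c(1)] by auto
  have "A $$ (c, b) \<in> {0, 1}" using A c(1) Suc.prems(1) unfolding zero_one_matrix_def by blast
  moreover have "A $$ (c, b) \<noteq> 0" using c(2) by (metis mult_zero_right)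
  ultimately have "A $$ (c, b) = 1" by blast
  then have "walk M A c [c] b" using c(1) Suc.prems(1) by simp
  from walk_append[OF w(2) this] have "walk M A a (w @ [c]) b" .
  moreover have "length (w @ [c]) = Suc n" using w(1) by simp
  ultimately show ?case by blast
qed

lemma exists_walk:
  assumes "zero_one_matrix M A" "irreducible_sft M A" "a < M" "b < M"
  shows "\<exists>w. w \<noteq> [] \<and> walk M A a w b"
proof -
  obtain n where "n > 0" "(A ^\<^sub>m n) $$ (a, b) > 0"
    using assms(2-4) unfolding irreducible_sft_def by blast
  then obtain w where "length w = n" "walk M A a w b"
    using exists_walk_of_pow_pos[OF assms(1,3,4)] by blast
  with \<open>n > 0\<close> show ?thesis by (intro exI[of _ w]) auto
qed

lemma walk_prefix_of:
  assumes "\<alpha> \<in> sft M A"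
  shows "walk M A (\<alpha> 0) (prefix_of \<alpha> k) (\<alpha> k)"
proof (induction k)
  case (Suc k)
  have "walk M A (\<alpha> k) [\<alpha> k] (\<alpha> (Suc k))" using assms by (simp add: sft_def)
  from walk_append[OF Suc this] show ?case by (simp only: prefix_of_Suc')
qed simp

definition orth :: "(nat \<Rightarrow> real^'n^'n) \<Rightarrow> nat list \<Rightarrow> real^'n^'n" where
  "orth T w = foldr (**) (map T w) (mat 1)"

lemma orth_simps [simp]: "orth T [] = mat 1" "orth T (i # w) = T i ** orth T w"
  by (auto simp: orth_def)

lemma orth_append [simp]: "orth T (u @ w) = orth T u ** orth T w"
  by (induction u) (auto simp: matrix_mul_assoc)

locale graph_directed_similarities =
  fixes M :: nat and A :: "nat mat" and r :: "nat \<Rightarrow> real" and T :: "nat \<Rightarrow> real^2^2"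
    and v :: "nat \<Rightarrow> real^2" and S :: "nat \<Rightarrow> real^2 \<Rightarrow> real^2" and j :: nat
  assumes A: "zero_one_matrix M A" and irr: "irreducible_sft M A"
    and r: "\<And>i. i < M \<Longrightarrow> 0 < r i \<and> r i < 1"
    and T: "\<And>i. i < M \<Longrightarrow> orthogonal_matrix (T i)"
    and S: "\<And>i. i < M \<Longrightarrow> S i = similarity (r i) (T i) (v i)"
    and j: "j < M"
begin

text \<open>The numbers \<open>c\<close> and \<open>R\<close> make the similarities an instance of the preceding locale; \<open>R\<close> solves
  \<open>c R + b = R\<close> for a bound \<open>b\<close> of the translation vectors.\<close>

definition c :: real where "c = Max (r ` {..<M})"

definition R :: real where "R = (1 + (\<Sum>i<M. norm (v i))) / (1 - c)"

lemma c_bounds: "c < 1" "i < M \<Longrightarrow> r i \<le> c"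
proof -
  show "c < 1" unfolding c_def using j r by (subst Max_less_iff) auto
  show "i < M \<Longrightarrow> r i \<le> c" by (simp add: c_def)
qed

lemma norm_orthogonal: "i < M \<Longrightarrow> norm (T i *v x) = norm x"
  using T[of i] orthogonal_transformation_norm[of "(*v) (T i)" x]
  by (simp add: orthogonal_transformation_matrix)

sublocale contracting_similarities "{..<M}" S r c R
proof
  show "finite {..<M}" "c < 1" by (simp_all add: c_bounds)
  have "0 \<le> (\<Sum>i<M. norm (v i))" by (simp add: sum_nonneg)
  then show "0 < R" using c_bounds(1) by (simp add: R_def)
  fix i assume i: "i \<in> {..<M}"
  then show "0 < r i" "r i \<le> c" using r c_bounds by auto
  show "dist (S i x) (S i y) = r i * dist x y" for x y
  proof -
    have "S i x - S i y = r i *\<^sub>R (T i *v (x - y))"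
      using i S by (simp add: similarity_def algebra_simps)
    then show ?thesis using i r[of i] norm_orthogonal[of i] by (simp add: dist_norm)
  qed
  show "norm (S i x) \<le> R" if x: "norm x \<le> R" for x
  proof -
    have "norm (S i x) \<le> r i * norm x + norm (v i)"
      using i S r[of i] norm_orthogonal[of i x] norm_triangle_ineq[of "r i *\<^sub>R (T i *v x)" "v i"]
      by (simp add: similarity_def)
    also have "\<dots> \<le> c * R + (1 + (\<Sum>i<M. norm (v i)))"
    proof (intro add_mono mult_mono)
      have "norm (v i) \<le> (\<Sum>i<M. norm (v i))" using i by (intro member_le_sum) auto
      then show "norm (v i) \<le> 1 + (\<Sum>i<M. norm (v i))" by simp
      show "r i \<le> c" "0 \<le> c" using i c_bounds(2)[of i] r[of i] by auto
    qed (use x in auto)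
    also have "1 + (\<Sum>i<M. norm (v i)) = R * (1 - c)" using c_bounds(1) by (simp add: R_def)
    finally show ?thesis by (simp add: algebra_simps)
  qed
qed

abbreviation loops :: "nat list set" where "loops \<equiv> loops_at M A j"

lemma loops_eq: "loops = {w. w \<noteq> [] \<and> walk M A j w j}"
  by (rule loops_at_eq[OF j])

lemma loops_alphabet: "w \<in> loops \<Longrightarrow> set w \<subseteq> {..<M}"
  by (auto simp: loops_at_def)

lemma loops_append: "u \<in> loops \<Longrightarrow> w \<in> loops \<Longrightarrow> u @ w \<in> loops"
  by (auto simp: loops_eq intro: walk_append)

lemma orthogonal_orth: "set w \<subseteq> {..<M} \<Longrightarrow> orthogonal_matrix (orth T w)"
  by (induction w) (auto simp: T orthogonal_matrix_id orthogonal_matrix_mul)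

lemma comp_word_similarity:
  "set w \<subseteq> {..<M} \<Longrightarrow> comp_word S w = similarity (ratio w) (orth T w) (comp_word S w 0)"
proof (induction w)
  case Nil
  then show ?case by (auto simp: similarity_def)
next
  case (Cons i w)
  then have "comp_word S w = similarity (ratio w) (orth T w) (comp_word S w 0)" by simp
  then have w: "comp_word S w x = ratio w *\<^sub>R (orth T w *v x) + comp_word S w 0" for x
    by (metis similarity_def)
  have "comp_word S (i # w) x = similarity (ratio (i # w)) (orth T (i # w)) (comp_word S (i # w) 0) x" for x
    using Cons.prems S[of i] w[of x]
    by (simp add: similarity_def matrix_vector_mul_assoc[symmetric] algebra_simps)
  then show ?case by (rule ext)
qed

lemma sft_sequences: "sft M A \<subseteq> sequences"
  by (auto simp: sft_def)

text \<open>Putting the word of a walk in front of an admissible sequence gives an admissible sequence. Hence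
  the composition along a loop maps the piece of the attractor at \<open>j\<close> into itself.\<close>

lemma walk_coding_map:
  assumes "walk M A a w b" "\<alpha> \<in> sft M A" "\<alpha> 0 = b"
  shows "\<exists>\<beta>\<in>sft M A. \<beta> 0 = a \<and> coding_map S \<beta> = comp_word S w (coding_map S \<alpha>)"
  using assms(1)
proof (induction w arbitrary: a)
  case Nil
  then show ?case using assms(2,3) by auto
next
  case (Cons x w)
  then obtain d where d: "x = a" "a < M" "d < M" "A $$ (a, d) = 1" "walk M A d w b" by auto
  from Cons.IH[OF d(5)] obtain \<beta> where \<beta>: "\<beta> \<in> sft M A" "\<beta> 0 = d"
      "coding_map S \<beta> = comp_word S w (coding_map S \<alpha>)" by blast
  have "case_nat a \<beta> \<in> sft M A" using \<beta> d by (auto simp: sft_def split: nat.splits)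
  moreover have "coding_map S (case_nat a \<beta>) = comp_word S (x # w) (coding_map S \<alpha>)"
    using coding_map_Cons[of a \<beta>] \<beta> d sft_sequences by auto
  ultimately show ?case by (intro bexI[of _ "case_nat a \<beta>"]) auto
qed

lemma sft_attractor_at_invariant:
  assumes "w \<in> loops" "x \<in> sft_attractor_at M A S j"
  shows "comp_word S w x \<in> sft_attractor_at M A S j"
proof -
  obtain \<alpha> where \<alpha>: "\<alpha> \<in> sft M A" "\<alpha> 0 = j" "x = coding_map S \<alpha>"
    using assms(2) by (auto simp: sft_attractor_at_def)
  have "walk M A j w j" using assms(1) by (auto simp: loops_eq)
  from walk_coding_map[OF this \<alpha>(1,2)] obtain \<beta>
    where "\<beta> \<in> {\<alpha> \<in> sft M A. \<alpha> 0 = j}" "comp_word S w x = coding_map S \<beta>"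
    unfolding \<alpha>(3) mem_Collect_eq by (elim bexE conjE) simp
  then show ?thesis unfolding sft_attractor_at_def by (simp only: image_eqI)
qed

text \<open>The transition rules constrain two coordinates at a time; reading them as implications over the
  value of the first one shows that the subshift is closed.\<close>

lemma closed_sft_attractor_at: "closed (sft_attractor_at M A S j)"
proof -
  have coord: "continuous_on UNIV (\<lambda>\<alpha> :: nat \<Rightarrow> nat. \<alpha> i)" for i by (rule continuous_on_product_coordinates)
  have op: "open {\<alpha> :: nat \<Rightarrow> nat. Q (\<alpha> i)}" for i Q
    using open_vimage[OF open_discrete[of "Collect Q"] coord[of i]] by (simp add: vimage_def)
  have cl: "closed {\<alpha> :: nat \<Rightarrow> nat. Q (\<alpha> i)}" for i Q
    using op[of "\<lambda>x. \<not> Q x" i] by (simp add: closed_def Collect_neg_eq)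
  have "{\<alpha> \<in> sft M A. \<alpha> 0 = j} = {\<alpha>. (\<forall>i. \<alpha> i < M) \<and> (\<forall>i a. \<alpha> i = a \<longrightarrow> A $$ (a, \<alpha> (Suc i)) = 1) \<and> \<alpha> 0 = j}"
    by (auto simp: sft_def)
  also have "closed \<dots>"
  proof (intro closed_Collect_conj closed_Collect_all closed_Collect_imp)
    show "closed {\<alpha> :: nat \<Rightarrow> nat. \<alpha> i < M}" for i by (rule cl[of "\<lambda>x. x < M" i])
    show "open {\<alpha> :: nat \<Rightarrow> nat. \<alpha> i = a}" for i a by (rule op[of "\<lambda>x. x = a" i])
    show "closed {\<alpha> :: nat \<Rightarrow> nat. A $$ (a, \<alpha> (Suc i)) = 1}" for i a
      by (rule cl[of "\<lambda>x. A $$ (a, x) = 1" "Suc i"])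
    show "closed {\<alpha> :: nat \<Rightarrow> nat. \<alpha> 0 = j}" by (rule cl[of "\<lambda>x. x = j" 0])
  qed
  finally have "compact (coding_map S ` {\<alpha> \<in> sft M A. \<alpha> 0 = j})"
    by (rule compact_coding_image) (use sft_sequences in blast)
  then show ?thesis unfolding sft_attractor_at_def by (rule compact_imp_closed)
qed

lemma orth_inverse: "set w \<subseteq> {..<M} \<Longrightarrow> orth T w ** transpose (orth T w) = mat 1 \<and> transpose (orth T w) ** orth T w = mat 1"
  using orthogonal_orth by (auto simp: orthogonal_matrix_def)

text \<open>The semigroup of linear parts of loops is finitely generated within its group. Choose a walk \<open>u a\<close>
  from \<open>j\<close> to each letter \<open>a\<close>, empty for \<open>a = j\<close>, and assign to each edge from \<open>a\<close> to \<open>b\<close> the linear part of the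
  detour that goes along \<open>u a\<close>, over the edge and back along \<open>u b\<close>. Along a loop these elements
  telescope to the linear part of the loop. Each of them is a quotient of two loops, obtained by
  closing up at \<open>b\<close> with a common walk to \<open>j\<close>.\<close>

lemma exists_dense_loop:
  assumes w0: "w0 \<in> loops" "norm z0 = 1" "orth T w0 = rot z0"
  shows "\<exists>w\<in>loops. \<exists>p. norm p = 1 \<and> orth T w = rot p \<and> (\<forall>L0::nat. \<exists>L\<ge>L0.
           dense_subset (generate orthogonal_group {rot (z0 ^ L * p)})
             (sft_transformation_group M A T j \<inter> {R. rotation_matrix R}))"
proof -
  interpret group "orthogonal_group :: (real^2^2) monoid" by (rule group_orthogonal_group)
  define P where "P = orth T ` loops"
  have G: "sft_transformation_group M A T j = generate orthogonal_group P"
    by (simp add: sft_transformation_group_def P_def orth_def)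
  have P: "P \<subseteq> {Q. orthogonal_matrix Q}" using orthogonal_orth loops_alphabet by (auto simp: P_def)
  have loopP: "orth T w \<in> generate orthogonal_group P" if "w \<in> loops" for w
    unfolding P_def by (rule generate.incl[OF imageI[OF that]])
  define u where "u = (\<lambda>a. if a = j then [] else SOME w. walk M A j w a)"
  have u: "walk M A j (u a) a" if "a < M" for a
  proof (cases "a = j")
    case False
    have "\<exists>w. walk M A j w a" using exists_walk[OF A irr j that] by blast
    from someI_ex[OF this] show ?thesis using False by (simp add: u_def)
  qed (simp add: u_def)
  have uj: "u j = []" by (simp add: u_def)
  have ua: "set (u a) \<subseteq> {..<M}" if "a < M" for a using walk_alphabet[OF u[OF that]] .
  define step where "step = (\<lambda>(a, b). orth T (u a) ** T a ** transpose (orth T (u b)))"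
  define E where "E = step ` {(a, b). a < M \<and> b < M \<and> A $$ (a, b) = 1}"
  have "finite {(a, b). a < M \<and> b < M \<and> A $$ (a, b) = 1}"
    by (rule finite_subset[of _ "{..<M} \<times> {..<M}"]) auto
  then have finE: "finite E" unfolding E_def by (rule finite_imageI)
  have EG: "E \<subseteq> generate orthogonal_group P"
  proof
    fix X assume "X \<in> E"
    then obtain a b where ab: "a < M" "b < M" "A $$ (a, b) = 1" and X: "X = step (a, b)"
      by (auto simp: E_def)
    obtain q where q: "q \<noteq> []" "walk M A b q j" using exists_walk[OF A irr ab(2) j] by auto
    have "walk M A a [a] b" using ab by auto
    from walk_append[OF u[OF ab(1)] walk_append[OF this q(2)]] have l1: "u a @ [a] @ q \<in> loops"
      by (simp add: loops_eq)
    from walk_append[OF u[OF ab(2)] q(2)] have l2: "u b @ q \<in> loops" using q(1) by (simp add: loops_eq)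
    have qa: "set q \<subseteq> {..<M}" by (rule walk_alphabet[OF q(2)])
    define Y where "Y = orth T (u b @ q)"
    have Yo: "orthogonal_matrix Y" unfolding Y_def using ua[OF ab(2)] qa by (intro orthogonal_orth) auto
    then have "inv\<^bsub>orthogonal_group\<^esub> Y = transpose Y"
      by (intro inv_equality) (auto simp: orthogonal_group_def orthogonal_matrix_def)
    moreover have "inv\<^bsub>orthogonal_group\<^esub> Y \<in> generate orthogonal_group P"
      unfolding Y_def P_def by (rule generate.inv[OF imageI[OF l2]])
    ultimately have "transpose Y \<in> generate orthogonal_group P" by simp
    from generate.eng[OF loopP[OF l1] this]
    have "orth T (u a @ [a] @ q) \<otimes>\<^bsub>orthogonal_group\<^esub> transpose Y \<in> generate orthogonal_group P" .
    moreover have "orth T (u a @ [a] @ q) ** transpose Y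
        = orth T (u a) ** T a ** (orth T q ** transpose (orth T q)) ** transpose (orth T (u b))"
      by (simp add: Y_def matrix_transpose_mul matrix_mul_assoc)
    ultimately show "X \<in> generate orthogonal_group P"
      unfolding conjunct1[OF orth_inverse[OF qa]] by (simp add: X step_def orthogonal_group_def)
  qed
  have gen: "P \<subseteq> C" if C: "mat 1 \<in> C" "\<And>X Y. X \<in> C \<Longrightarrow> Y \<in> C \<Longrightarrow> X ** Y \<in> C" "E \<subseteq> C" for C
  proof -
    have tele: "orth T (u a) ** orth T w ** transpose (orth T (u b)) \<in> C"
      if "walk M A a w b" "a < M" "b < M" for a w b
      using that
    proof (induction w arbitrary: a)
      case Nil
      then show ?case using orth_inverse[OF ua[of b]] C(1) by simp
    next
      case (Cons x w)
      then obtain d where d: "x = a" "d < M" "A $$ (a, d) = 1" "walk M A d w b" by auto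
      have "orth T (u a) ** orth T (x # w) ** transpose (orth T (u b)) =
          orth T (u a) ** T a ** (transpose (orth T (u d)) ** orth T (u d)) ** orth T w ** transpose (orth T (u b))"
        unfolding conjunct2[OF orth_inverse[OF ua[OF d(2)]]] by (simp add: d(1) matrix_mul_assoc)
      also have "\<dots> = step (a, d) ** (orth T (u d) ** orth T w ** transpose (orth T (u b)))"
        by (simp add: step_def matrix_mul_assoc)
      also have "\<dots> \<in> C"
        using Cons.prems d C(3) by (intro C(2) Cons.IH) (auto simp: E_def)
      finally show ?case .
    qed
    show ?thesis
    proof
      fix X assume "X \<in> P"
      then obtain w where "w \<in> loops" "X = orth T w" by (auto simp: P_def)
      then show "X \<in> C" using tele[of j w j] j by (simp add: loops_eq uj)
    qed
  qed
  have mult: "X ** Y \<in> P" if "X \<in> P" "Y \<in> P" for X Y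
  proof -
    from that obtain a b where "a \<in> loops" "b \<in> loops" "X = orth T a" "Y = orth T b" by (auto simp: P_def)
    then show ?thesis unfolding P_def by (intro image_eqI[of _ _ "a @ b"]) (simp_all add: loops_append)
  qed
  have z0P: "rot z0 \<in> P" unfolding P_def w0(3)[symmetric] by (rule imageI[OF w0(1)])
  have "\<exists>p. norm p = 1 \<and> rot p \<in> P \<and> (\<forall>L0::nat. \<exists>L\<ge>L0.
           dense_subset (generate orthogonal_group {rot (z0 ^ L * p)})
             (generate orthogonal_group P \<inter> {R. rotation_matrix R}))"
    by (rule exists_dense_rotation[OF P mult w0(2) z0P finE EG gen])
  then obtain p where p: "norm p = 1" "rot p \<in> P" and dense: "\<forall>L0::nat. \<exists>L\<ge>L0.
           dense_subset (generate orthogonal_group {rot (z0 ^ L * p)})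
             (generate orthogonal_group P \<inter> {R. rotation_matrix R})" by (elim exE conjE)
  from p(2) obtain w where "w \<in> loops" "orth T w = rot p" unfolding P_def by (elim imageE) simp
  then show ?thesis using p(1) dense unfolding G by (intro bexI[of _ w] exI[of _ p] conjI)
qed

end

section \<open>Disjoint pieces of comparable size\<close>

lemma exists_large_fibre:
  assumes "finite B" "f ` A \<subseteq> B" "A \<noteq> {}"
  shows "\<exists>b. card A \<le> card B * card {a \<in> A. f a = b}"
proof (rule ccontr)
  assume "\<nexists>b. card A \<le> card B * card {a \<in> A. f a = b}"
  then have small: "card B * card {a \<in> A. f a = b} < card A" for b by (auto simp: not_le)
  have "B \<noteq> {}" using assms by auto
  have "card A = card (\<Union>b\<in>B. {a \<in> A. f a = b})"
    using assms(2) by (intro arg_cong[of _ _ card]) auto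
  also have "\<dots> \<le> (\<Sum>b\<in>B. card {a \<in> A. f a = b})" by (rule card_UN_le[OF assms(1)])
  finally have "card B * card A \<le> (\<Sum>b\<in>B. card B * card {a \<in> A. f a = b})"
    by (simp add: sum_distrib_left[symmetric])
  also have "\<dots> < (\<Sum>b\<in>B. card A)"
    using small by (intro sum_strict_mono assms(1) \<open>B \<noteq> {}\<close>)
  finally show False by simp
qed

text \<open>Members of the family are kept greedily. What is discarded meets a member that was kept, which
  will make enlargements of the kept sets cover everything.\<close>

lemma exists_maximal_disjoint_subfamily:
  assumes "finite W" "\<And>w. w \<in> W \<Longrightarrow> G w \<noteq> {}"
  shows "\<exists>V\<subseteq>W. disjoint_family_on G V \<and> (\<forall>w\<in>W. \<exists>u\<in>V. G w \<inter> G u \<noteq> {})"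
  using assms
proof (induction W)
  case empty
  then show ?case by (simp add: disjoint_family_on_def)
next
  case (insert x W)
  then obtain V where V: "V \<subseteq> W" "disjoint_family_on G V" "\<forall>w\<in>W. \<exists>u\<in>V. G w \<inter> G u \<noteq> {}" by auto
  show ?case
  proof (cases "\<exists>u\<in>V. G x \<inter> G u \<noteq> {}")
    case True
    then show ?thesis using V by (intro exI[of _ V]) auto
  next
    case False
    then have "disjoint_family_on G (insert x V)" using V(2) by (auto simp: disjoint_family_on_def)
    then show ?thesis using V insert.prems(1)[of x] by (intro exI[of _ "insert x V"]) auto
  qed
qed

lemma disjoint_family_on_reindex:
  assumes "disjoint_family_on (\<lambda>i. G (f i)) I" "\<And>i. i \<in> I \<Longrightarrow> G (f i) \<noteq> {}"
  shows "inj_on f I" "disjoint_family_on G (f ` I)"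
proof -
  show "inj_on f I"
  proof (rule inj_onI, rule ccontr)
    fix x y assume "x \<in> I" "y \<in> I" "f x = f y" "x \<noteq> y"
    then have "G (f x) \<inter> G (f y) = {}" using assms(1) unfolding disjoint_family_on_def by blast
    then show False using \<open>f x = f y\<close> assms(2)[OF \<open>x \<in> I\<close>] by simp
  qed
  show "disjoint_family_on G (f ` I)"
    unfolding disjoint_family_on_def
  proof (intro ballI impI)
    fix a b assume "a \<in> f ` I" "b \<in> f ` I" "a \<noteq> b"
    then obtain x y where "x \<in> I" "y \<in> I" "a = f x" "b = f y" "x \<noteq> y" by auto
    then show "G a \<inter> G b = {}" using assms(1) unfolding disjoint_family_on_def by auto
  qed
qed

context graph_directed_similarities
begin

abbreviation piece :: "nat list \<Rightarrow> (real^2) set" where "piece w \<equiv> comp_word S w ` cball 0 R"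

lemma piece_nonempty: "piece w \<noteq> {}"
  using R0 by auto

lemma piece_append_subset:
  assumes "set w \<subseteq> {..<M}"
  shows "piece (u @ w) \<subseteq> comp_word S u ` cball 0 R"
  using comp_word_ball[OF assms] by (auto simp: comp_word_append)

lemma dist_in_piece:
  assumes "set w \<subseteq> {..<M}" "x \<in> piece w" "y \<in> piece w"
  shows "dist x y \<le> ratio w * (2 * R)"
proof -
  obtain x' y' where xy: "x' \<in> cball 0 R" "y' \<in> cball 0 R" "x = comp_word S w x'" "y = comp_word S w y'"
    using assms(2,3) by blast
  have "dist x' y' \<le> 2 * R"
    using xy(1,2) norm_triangle_ineq4[of x' y'] by (simp add: dist_norm)
  then show ?thesis
    using ratio_pos[OF assms(1)] by (simp add: xy dist_comp_word[OF assms(1)])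
qed

lemma coding_map_in_piece:
  assumes "\<alpha> \<in> sft M A"
  shows "coding_map S \<alpha> \<in> piece (prefix_of \<alpha> k)"
proof -
  have \<alpha>: "\<alpha> \<in> sequences" using assms sft_sequences by blast
  show ?thesis
    by (subst coding_map_split[OF \<alpha>, of k]) (rule imageI[OF coding_map_ball[OF shift_sequences[OF \<alpha>]]])
qed

text \<open>A word belongs to scale \<open>\<delta>\<close> if it is the first prefix of an admissible sequence whose ratio
  drops to \<open>\<delta>\<close>. Such words have ratios comparable to \<open>\<delta>\<close>, although their lengths may differ.\<close>

definition scale_words :: "real \<Rightarrow> nat list set" where
  "scale_words \<delta> = {prefix_of \<alpha> (Suc k) | \<alpha> k. \<alpha> \<in> sft M A \<and>
     ratio (prefix_of \<alpha> (Suc k)) \<le> \<delta> \<and> \<delta> < ratio (prefix_of \<alpha> k)}"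

definition r_min :: real where "r_min = Min (r ` {..<M})"

lemma r_min: "0 < r_min" "i < M \<Longrightarrow> r_min \<le> r i"
proof -
  show "0 < r_min" unfolding r_min_def using j r by (subst Min_gr_iff) auto
  show "i < M \<Longrightarrow> r_min \<le> r i" by (simp add: r_min_def)
qed

lemma scale_words_props:
  assumes "w \<in> scale_words \<delta>" "0 < \<delta>"
  shows "set w \<subseteq> {..<M}" "ratio w \<le> \<delta>" "r_min * \<delta> \<le> ratio w" "\<exists>b<M. walk M A (hd w) w b" "hd w < M"
proof -
  obtain \<alpha> k where \<alpha>: "\<alpha> \<in> sft M A" and w: "w = prefix_of \<alpha> (Suc k)"
    and \<delta>: "ratio w \<le> \<delta>" "\<delta> < ratio (prefix_of \<alpha> k)"
    using assms(1) unfolding scale_words_def by blast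
  have seq: "\<alpha> \<in> sequences" using \<alpha> sft_sequences by blast
  then have \<alpha>M: "\<alpha> i < M" for i by simp
  show "set w \<subseteq> {..<M}" unfolding w by (rule set_prefix_of[OF seq])
  show "ratio w \<le> \<delta>" by fact
  have "r_min * \<delta> \<le> r (\<alpha> k) * ratio (prefix_of \<alpha> k)"
    using r_min(1) r_min(2)[OF \<alpha>M[of k]] \<delta>(2) assms(2) by (intro mult_mono) auto
  then show "r_min * \<delta> \<le> ratio w" by (simp add: w prefix_of_Suc' mult.commute)
  have hd: "hd w = \<alpha> 0" by (simp add: w prefix_of_Suc)
  show "hd w < M" using \<alpha>M by (simp add: hd)
  show "\<exists>b<M. walk M A (hd w) w b"
    using walk_prefix_of[OF \<alpha>, of "Suc k", folded w hd] \<alpha>M[of "Suc k"] by (intro exI[of _ "\<alpha> (Suc k)"] conjI)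
qed

lemma finite_scale_words:
  assumes "0 < \<delta>"
  shows "finite (scale_words \<delta>)"
proof -
  have ne: "{..<M} \<noteq> {}" using j by auto
  have "(\<lambda>k. 1 * c ^ k) \<longlonglongrightarrow> 0" by (rule pow_c_tendsto[OF ne])
  then have "\<forall>\<^sub>F k in sequentially. c ^ k < \<delta>" using assms by (simp add: order_tendstoD(2))
  then obtain N where N: "c ^ k < \<delta>" if "N \<le> k" for k by (auto simp: eventually_sequentially)
  have "scale_words \<delta> \<subseteq> {w. set w \<subseteq> {..<M} \<and> length w \<le> N}"
  proof
    fix w assume w: "w \<in> scale_words \<delta>"
    then obtain \<alpha> k where \<alpha>: "\<alpha> \<in> sft M A" "w = prefix_of \<alpha> (Suc k)" "\<delta> < ratio (prefix_of \<alpha> k)"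
      unfolding scale_words_def by blast
    have "\<alpha> \<in> sequences" using \<alpha>(1) sft_sequences by blast
    from ratio_le[OF set_prefix_of[OF this], of k] \<alpha>(3) have "\<not> N \<le> k" using N[of k] by auto
    then show "w \<in> {w. set w \<subseteq> {..<M} \<and> length w \<le> N}"
      using scale_words_props(1)[OF w assms] \<alpha>(2) by simp
  qed
  then show ?thesis by (rule finite_subset) (rule finite_lists_length_le, simp)
qed

lemma scale_words_cover:
  assumes "0 < \<delta>" "\<delta> < 1"
  shows "sft_attractor M A S \<subseteq> (\<Union>w\<in>scale_words \<delta>. piece w)"
proof
  fix x assume "x \<in> sft_attractor M A S"
  then obtain \<alpha> where \<alpha>: "\<alpha> \<in> sft M A" "x = coding_map S \<alpha>" by (auto simp: sft_attractor_def)
  have seq: "\<alpha> \<in> sequences" using \<alpha>(1) sft_sequences by blast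
  have ne: "{..<M} \<noteq> {}" using j by auto
  have "(\<lambda>k. 1 * c ^ k) \<longlonglongrightarrow> 0" by (rule pow_c_tendsto[OF ne])
  then have "\<forall>\<^sub>F k in sequentially. c ^ k < \<delta>" using assms by (simp add: order_tendstoD(2))
  then obtain N where "c ^ N < \<delta>" by (auto simp: eventually_sequentially)
  then have ex: "ratio (prefix_of \<alpha> N) \<le> \<delta>"
    using ratio_le[OF set_prefix_of[OF seq], of N] by simp
  define m where "m = (LEAST k. ratio (prefix_of \<alpha> k) \<le> \<delta>)"
  have m: "ratio (prefix_of \<alpha> m) \<le> \<delta>" unfolding m_def using ex by (rule LeastI)
  have "m \<noteq> 0" using m assms(2) by (intro notI) simp
  then obtain k where k: "m = Suc k" by (cases m) auto
  then have "\<not> ratio (prefix_of \<alpha> k) \<le> \<delta>" using not_less_Least[of k "\<lambda>k. ratio (prefix_of \<alpha> k) \<le> \<delta>"] unfolding m_def by simp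
  then have "\<delta> < ratio (prefix_of \<alpha> k)" by simp
  then have "prefix_of \<alpha> m \<in> scale_words \<delta>"
    using \<alpha>(1) m unfolding k scale_words_def by blast
  moreover have "x \<in> piece (prefix_of \<alpha> m)" unfolding \<alpha>(2) by (rule coding_map_in_piece[OF \<alpha>(1)])
  ultimately show "x \<in> (\<Union>w\<in>scale_words \<delta>. piece w)" by blast
qed

text \<open>By irreducibility each word becomes part of a loop at \<open>j\<close> at a bounded cost. The prefix depends on
  the first letter of the word only, which later preserves disjointness of pieces. If the loop reverses orientation,
  one fixed orientation reversing loop is appended; its ratio is included in the constant.\<close>

lemma rotation_extension:
  "\<exists>c0>0. \<forall>a<M. \<exists>u. set u \<subseteq> {..<M} \<and> (\<forall>b<M. \<forall>w. walk M A a w b \<longrightarrow>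
     (\<exists>q. set q \<subseteq> {..<M} \<and> u @ w @ q \<in> loops \<and> rotation_matrix (orth T (u @ w @ q)) \<and> c0 \<le> ratio u * ratio q))"
proof -
  define path where "path = (\<lambda>a b. SOME w. w \<noteq> [] \<and> walk M A a w b)"
  have path: "path a b \<noteq> [] \<and> walk M A a (path a b) b" if "a < M" "b < M" for a b
    unfolding path_def using exists_walk[OF A irr that] by (rule someI_ex)
  have path_set: "set (path a b) \<subseteq> {..<M}" if "a < M" "b < M" for a b
    using walk_alphabet path[OF that] by blast
  \<comment> \<open>g is the fixed orientation reversing loop; it is empty if all loops preserve orientation\<close>
  obtain g where g: "set g \<subseteq> {..<M}" "g = [] \<or> g \<in> loops"
    "\<And>w. w \<in> loops \<Longrightarrow> \<not> rotation_matrix (orth T w) \<Longrightarrow> g \<in> loops \<and> \<not> rotation_matrix (orth T g)"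
  proof (cases "\<exists>g\<in>loops. \<not> rotation_matrix (orth T g)")
    case True
    then obtain g where "g \<in> loops" "\<not> rotation_matrix (orth T g)" by blast
    then show thesis using that[of g] loops_alphabet[of g] by blast
  next
    case False
    then show thesis using that[of "[]"] by auto
  qed
  define C where "C = (\<lambda>(a, b). ratio (path j a) * (ratio (path b j) * ratio g)) ` ({..<M} \<times> {..<M})"
  have "finite C" "C \<noteq> {}" using j by (auto simp: C_def)
  have Cpos: "0 < x" if "x \<in> C" for x
  proof -
    from that obtain p where p: "x = (case p of (a, b) \<Rightarrow> ratio (path j a) * (ratio (path b j) * ratio g))"
        "p \<in> {..<M} \<times> {..<M}"
      unfolding C_def by (rule imageE)
    obtain a b where ab: "p = (a, b)" by (cases p)
    have "a < M" "b < M" "x = ratio (path j a) * (ratio (path b j) * ratio g)" using p by (simp_all add: ab)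
    then show ?thesis using ratio_pos[OF path_set] ratio_pos[OF g(1)] j by simp
  qed
  show ?thesis
  proof (intro exI[of _ "Min C"] conjI allI impI)
    show "0 < Min C" using Cpos \<open>finite C\<close> \<open>C \<noteq> {}\<close> by simp
    fix a assume a: "a < M"
    show "\<exists>u. set u \<subseteq> {..<M} \<and> (\<forall>b<M. \<forall>w. walk M A a w b \<longrightarrow>
     (\<exists>q. set q \<subseteq> {..<M} \<and> u @ w @ q \<in> loops \<and> rotation_matrix (orth T (u @ w @ q)) \<and> Min C \<le> ratio u * ratio q))"
    proof (rule exI[of _ "path j a"], intro conjI allI impI)
      show "set (path j a) \<subseteq> {..<M}" by (rule path_set[OF j a])
      fix b w assume b: "b < M" and w: "walk M A a w b"
      define l where "l = path j a @ w @ path b j"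
      have "walk M A j l j" unfolding l_def
        by (intro walk_append[OF conjunct2[OF path[OF j a]]] walk_append[OF w] conjunct2[OF path[OF b j]])
      then have l: "l \<in> loops" using path[OF j a] by (simp add: loops_eq l_def)
      have "ratio (path j a) * (ratio (path b j) * ratio g) \<in> C"
        unfolding C_def by (rule image_eqI[of _ _ "(a, b)"]) (use a b in simp_all)
      then have bound: "Min C \<le> ratio (path j a) * (ratio (path b j) * ratio g)"
        using \<open>finite C\<close> by simp
      show "\<exists>q. set q \<subseteq> {..<M} \<and> path j a @ w @ q \<in> loops \<and>
          rotation_matrix (orth T (path j a @ w @ q)) \<and> Min C \<le> ratio (path j a) * ratio q"
      proof (cases "rotation_matrix (orth T l)")
        case True
        have "ratio (path j a) * (ratio (path b j) * ratio g) \<le> ratio (path j a) * (ratio (path b j) * 1)"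
          using ratio_le_1[OF g(1)] ratio_pos[OF path_set[OF j a]] ratio_pos[OF path_set[OF b j]]
          by (intro mult_left_mono) auto
        with bound have "Min C \<le> ratio (path j a) * ratio (path b j)" by simp
        then show ?thesis using True l path_set[OF b j] unfolding l_def by blast
      next
        case False
        then have gl: "g \<in> loops" "\<not> rotation_matrix (orth T g)" using g(3)[OF l] by blast+
        have lg: "l @ g \<in> loops" by (rule loops_append[OF l gl(1)])
        have "orthogonal_matrix (orth T l)" "orthogonal_matrix (orth T g)"
          using orthogonal_orth loops_alphabet l gl(1) by blast+
        then have "det (orth T l) = -1" "det (orth T g) = -1"
          using False gl(2) det_orthogonal_matrix unfolding rotation_matrix_def by blast+
        then have "det (orth T (l @ g)) = 1" by (simp add: det_mul)
        then have "rotation_matrix (orth T (l @ g))"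
          using orthogonal_orth[OF loops_alphabet[OF lg]] by (simp add: rotation_matrix_def)
        moreover have "l @ g = path j a @ w @ (path b j @ g)" by (simp add: l_def)
        moreover have "Min C \<le> ratio (path j a) * ratio (path b j @ g)" using bound by simp
        moreover have "set (path b j @ g) \<subseteq> {..<M}" using path_set[OF b j] g(1) by simp
        ultimately show ?thesis using lg by (intro exI[of _ "path b j @ g"]) simp
      qed
    qed
  qed
qed

text \<open>A maximal disjoint subfamily of the pieces at scale \<open>\<delta>\<close> covers the attractor after enlargement to
  balls of radius \<open>3 R \<delta>\<close>: a point of a piece is \<open>2 R \<delta>\<close>-close to a point of some member of the
  subfamily, and that point is \<open>R \<delta>\<close>-close to the image of the origin. Covers at scale \<open>\<delta>\<close> cannot
  be small.\<close>

lemma many_disjoint_scale_words: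
  assumes "sft_attractor M A S \<noteq> {}" "ereal t < hausdorff_dim (sft_attractor M A S)"
  shows "\<exists>c1>0. \<exists>\<delta>1>0. \<forall>\<delta>. 0 < \<delta> \<longrightarrow> \<delta> \<le> \<delta>1 \<longrightarrow> (\<exists>V\<subseteq>scale_words \<delta>. disjoint_family_on piece V \<and>
           c1 \<le> real (card V) * \<delta> powr t)"
proof -
  obtain c' \<delta>0 where c': "0 < c'" and \<delta>0: "0 < \<delta>0"
    and cov: "\<And>\<delta> \<U>. 0 < \<delta> \<Longrightarrow> \<delta> \<le> \<delta>0 \<Longrightarrow> finite \<U> \<Longrightarrow> sft_attractor M A S \<subseteq> \<Union>\<U> \<Longrightarrow>
        (\<forall>U\<in>\<U>. bounded U \<and> diameter U \<le> \<delta>) \<Longrightarrow> c' \<le> real (card \<U>) * \<delta> powr t"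
    using finite_cover_card_lower_bound[OF assms] by blast
  show ?thesis
  proof (rule exI[of _ "c' / (6 * R) powr t"], rule conjI, goal_cases pos bound)
    case pos
    show ?case using c' R0 by simp
  next
    case bound
    show ?case
    proof (rule exI[of _ "min (1/2) (\<delta>0 / (6 * R))"], intro conjI allI impI)
      show "0 < min (1/2) (\<delta>0 / (6 * R))" using \<delta>0 R0 by simp
      fix \<delta> assume \<delta>: "0 < \<delta>" "\<delta> \<le> min (1/2) (\<delta>0 / (6 * R))"
      obtain V where V: "V \<subseteq> scale_words \<delta>" "disjoint_family_on piece V"
          "\<forall>w\<in>scale_words \<delta>. \<exists>u\<in>V. piece w \<inter> piece u \<noteq> {}"
        using exists_maximal_disjoint_subfamily[OF finite_scale_words[OF \<delta>(1)], of piece] piece_nonempty by blast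
      have finV: "finite V" using finite_subset[OF V(1) finite_scale_words[OF \<delta>(1)]] .
      define \<U> where "\<U> = (\<lambda>u. cball (comp_word S u 0) (3 * R * \<delta>)) ` V"
      have "sft_attractor M A S \<subseteq> \<Union>\<U>"
      proof
        fix x assume "x \<in> sft_attractor M A S"
        then obtain w where w: "w \<in> scale_words \<delta>" "x \<in> piece w"
          using scale_words_cover[of \<delta>] \<delta> by auto
        then obtain u y where u: "u \<in> V" "y \<in> piece w" "y \<in> piece u" using V(3) by blast
        have us: "u \<in> scale_words \<delta>" using u(1) V(1) by blast
        have "dist x y \<le> \<delta> * (2 * R)"
          by (rule order_trans[OF dist_in_piece[OF scale_words_props(1)[OF w(1) \<delta>(1)] w(2) u(2)]
            mult_right_mono[OF scale_words_props(2)[OF w(1) \<delta>(1)]]]) (use R0 in simp)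
        moreover have "dist (comp_word S u 0) y \<le> \<delta> * R"
        proof -
          obtain y' where y': "y' \<in> cball 0 R" "y = comp_word S u y'" using u(3) by blast
          have "dist (comp_word S u 0) y = ratio u * norm y'"
            unfolding y'(2) dist_comp_word[OF scale_words_props(1)[OF us \<delta>(1)]] by (simp add: dist_norm)
          also have "\<dots> \<le> \<delta> * R"
            using scale_words_props(2)[OF us \<delta>(1)] y'(1) \<delta>(1) by (intro mult_mono) auto
          finally show ?thesis .
        qed
        ultimately have "dist (comp_word S u 0) x \<le> 3 * R * \<delta>"
          using dist_triangle3[of "comp_word S u 0" x y] by (simp add: dist_commute algebra_simps)
        then show "x \<in> \<Union>\<U>" using u(1) by (auto simp: \<U>_def)
      qed
      moreover have "\<forall>U\<in>\<U>. bounded U \<and> diameter U \<le> 6 * R * \<delta>"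
        using R0 \<delta>(1) by (auto simp: \<U>_def)
      moreover have "6 * R * \<delta> \<le> \<delta>0" using \<delta>(2) R0 by (simp add: field_simps)
      moreover have "0 < 6 * R * \<delta>" using \<delta>(1) R0 by simp
      moreover have "finite \<U>" using finV by (simp add: \<U>_def)
      ultimately have "c' \<le> real (card \<U>) * (6 * R * \<delta>) powr t" by (intro cov)
      also have "\<dots> \<le> real (card V) * (6 * R * \<delta>) powr t"
        using card_image_le[OF finV] unfolding \<U>_def by (intro mult_right_mono) auto
      also have "\<dots> = (real (card V) * \<delta> powr t) * (6 * R) powr t"
        using R0 \<delta>(1) by (simp add: powr_mult)
      finally have "c' / (6 * R) powr t \<le> real (card V) * \<delta> powr t"
        using R0 by (simp add: field_simps)
      then show "\<exists>V\<subseteq>scale_words \<delta>. disjoint_family_on piece V \<and> c' / (6 * R) powr t \<le> real (card V) * \<delta> powr t"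
        using V by blast
    qed
  qed
qed

text \<open>An exponent \<open>t\<close> strictly between \<open>s\<close> and the dimension provides \<open>\<delta> powr (- t)\<close> disjoint pieces up to
  a constant, for each small \<open>\<delta>\<close>. Restricting to the most frequent first letter and extending the words to loops
  changes the number and the ratios by bounded factors only. So the number of loops times the \<open>s\<close>-th
  power of their ratios is at least a constant \<open>C\<close> times \<open>\<delta> powr (s - t)\<close>, which exceeds \<open>1\<close> for small
  \<open>\<delta>\<close>.\<close>

lemma exists_separated_rotation_loops:
  assumes ne: "sft_attractor M A S \<noteq> {}" and s: "ereal s < hausdorff_dim (sft_attractor M A S)"
  shows "\<exists>X \<kappa>. finite X \<and> X \<subseteq> loops \<and> disjoint_family_on piece X \<and> 0 < \<kappa> \<and>
    (\<forall>w\<in>X. rotation_matrix (orth T w) \<and> \<kappa> \<le> ratio w) \<and> 1 < real (card X) * \<kappa> powr s"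
proof -
  obtain t where "ereal s < ereal t" and t2: "ereal t < hausdorff_dim (sft_attractor M A S)"
    using ereal_dense2[OF s] by blast
  then have t: "s < t" "ereal t < hausdorff_dim (sft_attractor M A S)" by simp_all
  obtain c1 \<delta>1 where c1: "0 < c1" and \<delta>1: "0 < \<delta>1"
    and many: "\<And>\<delta>. 0 < \<delta> \<Longrightarrow> \<delta> \<le> \<delta>1 \<Longrightarrow> \<exists>V\<subseteq>scale_words \<delta>. disjoint_family_on piece V \<and>
           c1 \<le> real (card V) * \<delta> powr t"
    using many_disjoint_scale_words[OF ne t(2)] by blast
  obtain c0 where c0: "0 < c0" and ext: "\<And>a. a < M \<Longrightarrow> \<exists>u. set u \<subseteq> {..<M} \<and> (\<forall>b<M. \<forall>w. walk M A a w b \<longrightarrow>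
     (\<exists>q. set q \<subseteq> {..<M} \<and> u @ w @ q \<in> loops \<and> rotation_matrix (orth T (u @ w @ q)) \<and> c0 \<le> ratio u * ratio q))"
    using rotation_extension by blast
  define C where "C = c1 / real M * (c0 * r_min) powr s"
  have C: "0 < C" using c1 c0 r_min(1) j by (simp add: C_def)
  define \<delta> where "\<delta> = min \<delta>1 ((C / 2) powr (1 / (t - s)))"
  have \<delta>: "0 < \<delta>" "\<delta> \<le> \<delta>1" using \<delta>1 C by (simp_all add: \<delta>_def)
  have "\<delta> powr (t - s) \<le> ((C / 2) powr (1 / (t - s))) powr (t - s)"
    using \<delta>(1) t(1) by (intro powr_mono2) (auto simp: \<delta>_def)
  also have "\<dots> = C / 2" using t(1) C by (simp add: powr_powr)
  finally have small: "\<delta> powr (t - s) < C" using C by simp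
  obtain V where V: "V \<subseteq> scale_words \<delta>" "disjoint_family_on piece V" "c1 \<le> real (card V) * \<delta> powr t"
    using many[OF \<delta>] by blast
  have Vne: "V \<noteq> {}" using V(3) c1 by auto
  have finV: "finite V" using finite_subset[OF V(1) finite_scale_words[OF \<delta>(1)]] .
  have Vp: "set w \<subseteq> {..<M}" "r_min * \<delta> \<le> ratio w" "\<exists>b<M. walk M A (hd w) w b" "hd w < M" if "w \<in> V" for w
    using scale_words_props[of w \<delta>] that V(1) \<delta>(1) by blast+
  obtain a where a: "card V \<le> card {..<M} * card {w \<in> V. hd w = a}"
    using exists_large_fibre[of "{..<M}" hd V] Vp(4) Vne by auto
  define Va where "Va = {w \<in> V. hd w = a}"
  have "0 < card V" using Vne finV by (simp add: card_gt_0_iff)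
  with a have "card Va \<noteq> 0" unfolding Va_def by (intro notI) simp
  then have "Va \<noteq> {}" by auto
  then have aM: "a < M" using Vp(4) by (auto simp: Va_def)
  obtain u where u: "set u \<subseteq> {..<M}" and ext_u: "\<And>b w. b < M \<Longrightarrow> walk M A a w b \<Longrightarrow>
     \<exists>q. set q \<subseteq> {..<M} \<and> u @ w @ q \<in> loops \<and> rotation_matrix (orth T (u @ w @ q)) \<and> c0 \<le> ratio u * ratio q"
    using ext[OF aM] by blast
  have "\<forall>w\<in>Va. \<exists>q. set q \<subseteq> {..<M} \<and> u @ w @ q \<in> loops \<and> rotation_matrix (orth T (u @ w @ q)) \<and> c0 \<le> ratio u * ratio q"
    using Vp(3) ext_u by (fastforce simp: Va_def)
  then obtain q where q: "\<And>w. w \<in> Va \<Longrightarrow> set (q w) \<subseteq> {..<M} \<and> u @ w @ q w \<in> loops \<and>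
      rotation_matrix (orth T (u @ w @ q w)) \<and> c0 \<le> ratio u * ratio (q w)" by metis
  define f where "f = (\<lambda>w. u @ w @ q w)"
  have "disjoint_family_on (\<lambda>w. piece (f w)) Va"
    unfolding disjoint_family_on_def
  proof (intro ballI impI)
    fix w w' assume w: "w \<in> Va" "w' \<in> Va" "w \<noteq> w'"
    have sub: "piece (f w) \<subseteq> comp_word S u ` piece w" if "w \<in> Va" for w
    proof -
      have "piece (w @ q w) \<subseteq> piece w" using q[OF that] by (intro piece_append_subset) blast
      then have "comp_word S u ` piece (w @ q w) \<subseteq> comp_word S u ` piece w" by (rule image_mono)
      then show ?thesis by (simp only: f_def comp_word_append[of S u] image_comp[symmetric])
    qed
    have "piece w \<inter> piece w' = {}" using w V(2) unfolding Va_def disjoint_family_on_def by blast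
    then have "comp_word S u ` piece w \<inter> comp_word S u ` piece w' = {}"
      by (simp only: image_Int[OF inj_comp_word[OF u], symmetric] image_empty)
    with Int_mono[OF sub[OF w(1)] sub[OF w(2)]]
    show "piece (f w) \<inter> piece (f w') = {}" by (simp only: subset_empty)
  qed
  note dis = disjoint_family_on_reindex[where G = piece and f = f and I = Va, OF this piece_nonempty]
  define X where "X = f ` Va"
  define \<kappa> where "\<kappa> = c0 * r_min * \<delta>"
  have \<kappa>: "0 < \<kappa>" using c0 r_min(1) \<delta>(1) by (simp add: \<kappa>_def)
  have cardX: "card X = card Va" unfolding X_def by (rule card_image[OF dis(1)])
  have ratio_f: "\<kappa> \<le> ratio (f w)" if "w \<in> Va" for w
  proof -
    have "c0 * (r_min * \<delta>) \<le> (ratio u * ratio (q w)) * ratio w"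
      using q[OF that] Vp(2)[of w] that c0 r_min(1) \<delta>(1) by (intro mult_mono) (auto simp: Va_def)
    then show ?thesis by (simp add: \<kappa>_def f_def mult_ac)
  qed
  have "1 < C / \<delta> powr (t - s)" using small \<delta>(1) by (simp add: field_simps)
  also have "\<dots> = c1 / \<delta> powr t / real M * \<kappa> powr s"
    using c0 r_min(1) \<delta>(1) by (simp add: C_def \<kappa>_def powr_mult powr_diff field_simps)
  also have "\<dots> \<le> real (card X) * \<kappa> powr s"
  proof (rule mult_right_mono)
    have "c1 / \<delta> powr t \<le> real (card V)" using V(3) \<delta>(1) by (simp add: field_simps)
    also have "\<dots> \<le> real (M * card Va)" using a by (simp add: Va_def del: of_nat_mult)
    finally have "c1 / \<delta> powr t \<le> real (card X) * real M" by (simp add: cardX mult.commute)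
    moreover have "0 < real M" using j by simp
    ultimately show "c1 / \<delta> powr t / real M \<le> real (card X)" by (simp only: pos_divide_le_eq)
  qed simp
  finally have "1 < real (card X) * \<kappa> powr s" .
  moreover have "finite X" using finV by (simp add: X_def Va_def)
  moreover have "X \<subseteq> loops" "\<forall>w\<in>X. rotation_matrix (orth T w) \<and> \<kappa> \<le> ratio w"
    using q ratio_f unfolding X_def f_def by blast+
  ultimately show ?thesis using dis(2) \<kappa> unfolding X_def by blast
qed

end

section \<open>Equalising the linear parts\<close>

definition words_of_length :: "'a set \<Rightarrow> nat \<Rightarrow> 'a list set" where
  "words_of_length X k = {ws. set ws \<subseteq> X \<and> length ws = k}"

lemma prod_list_eq_prod_count:
  fixes f :: "'a \<Rightarrow> 'b::comm_monoid_mult"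
  assumes "finite X" "set ws \<subseteq> X"
  shows "prod_list (map f ws) = (\<Prod>x\<in>X. f x ^ count_list ws x)"
  using assms(2)
proof (induction ws)
  case (Cons y ws)
  have "(\<Prod>x\<in>X. f x ^ count_list (y # ws) x) = (\<Prod>x\<in>X. (if x = y then f x else 1) * f x ^ count_list ws x)"
    by (intro prod.cong) auto
  also have "\<dots> = f y * (\<Prod>x\<in>X. f x ^ count_list ws x)"
    using assms(1) Cons.prems by (simp add: prod.distrib)
  finally show ?case using Cons by simp
qed simp

text \<open>In a commutative monoid the product over a list of length \<open>k\<close> is determined by the multiplicities, each
  of which is at most \<open>k\<close>. So there are at most \<open>Suc k ^ card X\<close> products.\<close>

lemma exists_common_product:
  fixes f :: "'a \<Rightarrow> 'b::comm_monoid_mult"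
  assumes X: "finite X" "X \<noteq> {}"
  shows "\<exists>\<zeta>. card X ^ k \<le> Suc k ^ card X * card {ws \<in> words_of_length X k. prod_list (map f ws) = \<zeta>}"
proof -
  define B where "B = (\<lambda>n. \<Prod>x\<in>X. f x ^ n x) ` (PiE X (\<lambda>_. {0..k}))"
  have fin: "finite (PiE X (\<lambda>_. {0..k}))" using X(1) by (simp add: finite_PiE)
  have cardB: "card B \<le> Suc k ^ card X"
    using card_image_le[OF fin, of "\<lambda>n. \<Prod>x\<in>X. f x ^ n x"] X(1) by (simp add: B_def card_PiE)
  have "(\<lambda>ws. prod_list (map f ws)) ` words_of_length X k \<subseteq> B"
  proof (rule image_subsetI)
    fix ws assume "ws \<in> words_of_length X k"
    then have ws: "set ws \<subseteq> X" "length ws = k" by (auto simp: words_of_length_def)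
    have "restrict (count_list ws) X \<in> PiE X (\<lambda>_. {0..k})"
      using count_le_length[of ws] ws(2) by auto
    moreover have "prod_list (map f ws) = (\<Prod>x\<in>X. f x ^ restrict (count_list ws) X x)"
      unfolding prod_list_eq_prod_count[OF X(1) ws(1)] by (intro prod.cong) auto
    ultimately show "prod_list (map f ws) \<in> B" unfolding B_def by (intro image_eqI)
  qed
  moreover have "words_of_length X k \<noteq> {}"
  proof -
    obtain x where "x \<in> X" using X(2) by auto
    then have "replicate k x \<in> words_of_length X k" by (auto simp: words_of_length_def)
    then show ?thesis by auto
  qed
  moreover have "finite B" unfolding B_def by (rule finite_imageI[OF fin])
  ultimately obtain \<zeta> where "card (words_of_length X k) \<le> card B * card {ws \<in> words_of_length X k. prod_list (map f ws) = \<zeta>}"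
    using exists_large_fibre[of B "\<lambda>ws. prod_list (map f ws)" "words_of_length X k"] by blast
  also have "\<dots> \<le> Suc k ^ card X * card {ws \<in> words_of_length X k. prod_list (map f ws) = \<zeta>}"
    using cardB by (rule mult_right_mono) simp
  finally show ?thesis using card_lists_length_eq[OF X(1), of k] by (auto simp: words_of_length_def)
qed

lemma exponential_beats_power:
  fixes q :: real
  assumes "1 < q"
  shows "\<exists>k\<ge>1. real (Suc k) ^ n < q ^ k"
proof -
  define b where "b = q powr (1 / real (Suc n))"
  have b1: "1 < b" using assms by (simp add: b_def)
  have bq: "b ^ Suc n = q" using assms by (simp add: b_def powr_realpow[symmetric] powr_powr del: power_Suc)
  have "(\<lambda>k. of_nat k * inverse b ^ k) \<longlonglongrightarrow> 0"
    using b1 by (intro powser_times_n_limit_0) (simp add: inverse_less_1_iff)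
  then have "\<forall>\<^sub>F k in sequentially. real k * inverse b ^ k < inverse 2"
    by (rule order_tendstoD(2)) simp
  then obtain N where N: "\<And>k. N \<le> k \<Longrightarrow> real k * inverse b ^ k < inverse 2"
    unfolding eventually_sequentially by blast
  define k where "k = Suc N"
  have "real k * inverse b ^ k < inverse 2" by (rule N) (simp add: k_def)
  then have "real k * 2 < b ^ k" using b1 by (simp add: power_inverse field_simps)
  then have "real (Suc k) < b ^ k" by (simp add: k_def)
  then have "real (Suc k) ^ Suc n < (b ^ k) ^ Suc n" by (intro power_strict_mono) simp_all
  also have "(b ^ k) ^ Suc n = (b ^ Suc n) ^ k" by (simp only: power_mult[symmetric] mult.commute)
  finally have "real (Suc k) ^ Suc n < q ^ k" unfolding bq .
  moreover have "real (Suc k) ^ n \<le> real (Suc k) ^ Suc n" by (intro power_increasing) auto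
  ultimately have "real (Suc k) ^ n < q ^ k" by (rule le_less_trans[rotated])
  then show ?thesis by (intro exI[of _ k]) (simp add: k_def)
qed

context graph_directed_similarities
begin

text \<open>Identifying the plane with the complex numbers, the linear part of an orientation preserving
  composition is multiplication by one complex number, whose modulus is the ratio. Unlike the maps
  themselves, these numbers commute.\<close>

definition multiplier :: "nat list \<Rightarrow> complex \<Rightarrow> bool" where
  "multiplier w \<zeta> \<longleftrightarrow> \<zeta> \<noteq> 0 \<and> ratio w = norm \<zeta> \<and> orth T w = rot (sgn \<zeta>)"

lemma multiplier_Nil: "multiplier [] 1"
  by (simp add: multiplier_def rot_1)

lemma multiplier_append: "multiplier u \<zeta> \<Longrightarrow> multiplier w \<xi> \<Longrightarrow> multiplier (u @ w) (\<zeta> * \<xi>)"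
  by (simp add: multiplier_def norm_mult sgn_mult rot_mirror_mult)

lemma multiplier_concat:
  "(\<And>w. w \<in> set ws \<Longrightarrow> multiplier w (f w)) \<Longrightarrow> multiplier (concat ws) (prod_list (map f ws))"
  by (induction ws) (auto simp: multiplier_Nil intro: multiplier_append)

lemma exists_multiplier:
  assumes "set w \<subseteq> {..<M}" "rotation_matrix (orth T w)"
  shows "\<exists>\<zeta>. multiplier w \<zeta>"
proof -
  obtain z where z: "norm z = 1" "orth T w = rot z" using assms(2) by (auto simp: rotation_matrix_2_iff)
  have "sgn z = z" using z(1) by (simp add: sgn_eq)
  then have "sgn (of_real (ratio w) * z) = z"
    using ratio_pos[OF assms(1)] by (simp add: sgn_mult sgn_of_real)
  moreover have "z \<noteq> 0" using z(1) by auto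
  ultimately have "multiplier w (of_real (ratio w) * z)"
    using ratio_pos[OF assms(1)] z by (simp add: multiplier_def norm_mult)
  then show ?thesis ..
qed

lemma concat_alphabet: "set ws \<subseteq> X \<Longrightarrow> X \<subseteq> loops \<Longrightarrow> set (concat ws) \<subseteq> {..<M}"
  using loops_alphabet by fastforce

lemma concat_loops: "set ws \<subseteq> X \<Longrightarrow> X \<subseteq> loops \<Longrightarrow> ws \<noteq> [] \<Longrightarrow> concat ws \<in> loops"
proof (induction ws)
  case (Cons w ws)
  then show ?case by (cases "ws = []") (auto simp: loops_append)
qed simp

lemma loop_ratio_less_1:
  assumes "w \<in> loops"
  shows "ratio w < 1"
proof -
  obtain i w' where w: "w = i # w'" using assms by (cases w) (auto simp: loops_eq)
  have i: "i < M" "set w' \<subseteq> {..<M}" using loops_alphabet[OF assms] by (auto simp: w)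
  have "ratio w \<le> r i * 1" unfolding w ratio_simps
    using ratio_le_1[OF i(2)] r[OF i(1)] by (intro mult_left_mono) auto
  then show ?thesis using r[OF i(1)] by simp
qed

text \<open>Two lists of loops part at some entry; there the pieces are disjoint, and the common beginning acts
  injectively. A common final word \<open>p\<close> only shrinks the pieces.\<close>

lemma disjoint_concat:
  assumes X: "X \<subseteq> loops" "disjoint_family_on piece X" and p: "set p \<subseteq> {..<M}"
  shows "disjoint_family_on (\<lambda>ws. piece (concat ws @ p)) (words_of_length X k)"
proof -
  have "piece (concat us @ p) \<inter> piece (concat ws @ p) = {}"
    if "set us \<subseteq> X" "set ws \<subseteq> X" "length us = length ws" "us \<noteq> ws" for us ws
    using that(3,1,2,4)
  proof (induction us ws rule: list_induct2)
    case (Cons u us w ws)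
    show ?case
    proof (cases "u = w")
      case True
      have u: "set u \<subseteq> {..<M}" using Cons.prems(1) X(1) loops_alphabet by auto
      have "piece (concat us @ p) \<inter> piece (concat ws @ p) = {}"
        using Cons.prems True by (intro Cons.IH) auto
      then have "comp_word S u ` piece (concat us @ p) \<inter> comp_word S u ` piece (concat ws @ p) = {}"
        by (simp only: image_Int[OF inj_comp_word[OF u], symmetric] image_empty)
      then show ?thesis
        using True by (simp only: concat.simps append_assoc comp_word_append[of S w "_ @ _"] image_comp[symmetric])
    next
      case False
      have "set (concat us @ p) \<subseteq> {..<M}" "set (concat ws @ p) \<subseteq> {..<M}"
        using concat_alphabet[OF _ X(1)] Cons.prems p by simp_all
      then have "piece (u @ (concat us @ p)) \<subseteq> piece u" "piece (w @ (concat ws @ p)) \<subseteq> piece w"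
        by (blast intro: piece_append_subset[THEN subsetD])+
      moreover have "piece u \<inter> piece w = {}"
        using False X(2) Cons.prems unfolding disjoint_family_on_def by simp
      ultimately have "piece (u @ (concat us @ p)) \<inter> piece (w @ (concat ws @ p)) = {}" by blast
      then show ?thesis by (simp only: concat.simps append_assoc)
    qed
  qed simp
  then show ?thesis unfolding disjoint_family_on_def words_of_length_def by simp
qed

text \<open>Among the \<open>n ^ k\<close> concatenations of \<open>k\<close> of the \<open>n\<close> given loops, at least the fraction
  \<open>1 / Suc k ^ n\<close> shares one multiplier. This loss is polynomial in \<open>k\<close>, whereas the surplus in the
  assumption is raised to the power \<open>k\<close>. A negative \<open>s\<close> needs separate treatment, since then larger ratios
  have smaller powers; but then a single loop is enough.\<close>

lemma exists_common_multiplier: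
  assumes X: "finite X" "X \<subseteq> loops" "disjoint_family_on piece X" and \<kappa>: "0 < \<kappa>"
    and rot: "\<And>w. w \<in> X \<Longrightarrow> rotation_matrix (orth T w) \<and> \<kappa> \<le> ratio w"
    and big: "1 < real (card X) * \<kappa> powr s"
  shows "\<exists>Y \<zeta>. finite Y \<and> Y \<subseteq> loops \<and> disjoint_family_on piece Y \<and>
    (\<forall>w\<in>Y. multiplier w \<zeta>) \<and> 1 < real (card Y) * norm \<zeta> powr s"
proof -
  have Xne: "X \<noteq> {}" using big by auto
  have "\<forall>w\<in>X. \<exists>\<zeta>. multiplier w \<zeta>" using exists_multiplier rot loops_alphabet X(2) by blast
  then obtain f where f: "\<And>w. w \<in> X \<Longrightarrow> multiplier w (f w)" by metis
  show ?thesis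
  proof (cases "s < 0")
    case True
    obtain w where w: "w \<in> X" using Xne by auto
    then have wl: "w \<in> loops" using X(2) by auto
    have "norm (f w) < 1" "norm (f w) > 0"
      using loop_ratio_less_1[OF wl] f[OF w] by (simp_all add: multiplier_def)
    then have "1 < norm (f w) powr s" using True powr_less_mono'[of "norm (f w)" s 0] by simp
    then show ?thesis using f[OF w] wl
      by (intro exI[of _ "{w}"] exI[of _ "f w"]) (auto simp: disjoint_family_on_def)
  next
    case False
    obtain k where k: "1 \<le> k" "real (Suc k) ^ card X < (real (card X) * \<kappa> powr s) ^ k"
      using exponential_beats_power[OF big] by blast
    obtain \<zeta> where \<zeta>: "card X ^ k \<le> Suc k ^ card X * card {ws \<in> words_of_length X k. prod_list (map f ws) = \<zeta>}"
      using exists_common_product[OF X(1) Xne] by blast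
    define W where "W = {ws \<in> words_of_length X k. prod_list (map f ws) = \<zeta>}"
    have W: "W \<subseteq> words_of_length X k" by (auto simp: W_def)
    have "finite (words_of_length X k)"
      using finite_lists_length_eq[OF X(1), of k] by (simp add: words_of_length_def)
    then have finW: "finite W" by (rule finite_subset[OF W])
    have \<zeta>W: "card X ^ k \<le> Suc k ^ card X * card W" using \<zeta> by (simp only: W_def)
    have "disjoint_family_on (\<lambda>ws. piece (concat ws @ [])) (words_of_length X k)"
      by (rule disjoint_concat[OF X(2,3)]) simp
    then have dW: "disjoint_family_on (\<lambda>ws. piece (concat ws)) W"
      using W unfolding disjoint_family_on_def by auto
    note dis = disjoint_family_on_reindex[where G = piece and f = concat and I = W, OF dW piece_nonempty]
    have mult: "multiplier (concat ws) \<zeta>" if "ws \<in> W" for ws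
    proof -
      have "set ws \<subseteq> X" "prod_list (map f ws) = \<zeta>" using that by (auto simp: W_def words_of_length_def)
      then show ?thesis using multiplier_concat[of ws f] f by auto
    qed
    have "W \<noteq> {}"
    proof
      assume "W = {}"
      then have "card X ^ k \<le> 0" using \<zeta>W by simp
      then show False using Xne X(1) by simp
    qed
    then obtain ws where ws: "ws \<in> W" by auto
    have low: "\<kappa> ^ length us \<le> ratio (concat us)" if "set us \<subseteq> X" for us
      using that
    proof (induction us)
      case (Cons u us)
      then show ?case using rot[of u] \<kappa> by (auto intro!: mult_mono)
    qed simp
    have "\<kappa> ^ k \<le> norm \<zeta>"
      using low[of ws] ws mult[OF ws] by (auto simp: W_def words_of_length_def multiplier_def)
    then have "(\<kappa> ^ k) powr s \<le> norm \<zeta> powr s" using \<kappa> False by (intro powr_mono2) auto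
    moreover have "(\<kappa> ^ k) powr s = (\<kappa> powr s) ^ k"
      using \<kappa> by (simp add: powr_powr powr_realpow[symmetric] mult.commute)
    ultimately have \<zeta>s: "(\<kappa> powr s) ^ k \<le> norm \<zeta> powr s" by simp
    have cardW: "real (card X) ^ k \<le> real (Suc k) ^ card X * real (card W)"
      using \<zeta>W unfolding of_nat_power[symmetric] of_nat_mult[symmetric] of_nat_le_iff .
    have "real (Suc k) ^ card X * 1 < real (card X) ^ k * (\<kappa> powr s) ^ k"
      using k(2) by (simp add: power_mult_distrib)
    also have "\<dots> \<le> (real (Suc k) ^ card X * real (card W)) * norm \<zeta> powr s"
      using cardW \<zeta>s by (intro mult_mono) auto
    also have "\<dots> = real (Suc k) ^ card X * (real (card W) * norm \<zeta> powr s)" by simp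
    finally have "1 < real (card W) * norm \<zeta> powr s"
      by (rule mult_left_less_imp_less) simp
    then have "1 < real (card (concat ` W)) * norm \<zeta> powr s" by (simp only: card_image[OF dis(1)])
    moreover have "concat ` W \<subseteq> loops"
    proof (rule image_subsetI)
      fix ws assume "ws \<in> W"
      then have "set ws \<subseteq> X" "ws \<noteq> []" using k(1) by (auto simp: W_def words_of_length_def)
      then show "concat ws \<in> loops" using concat_loops X(2) by blast
    qed
    moreover have "\<forall>w\<in>concat ` W. multiplier w \<zeta>" using mult by blast
    ultimately show ?thesis using dis(2) finW by blast
  qed
qed

text \<open>The loops with common multiplier \<open>\<zeta>\<close> are concatenated \<open>L\<close> times, and the loop that corrects the
  rotation is appended once. Its ratio is a constant, so it is outweighed by the \<open>L\<close>-th power of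
  a number greater than \<open>1\<close> for large \<open>L\<close>, and arbitrarily large \<open>L\<close> are admitted by
  \<open>exists_dense_loop\<close>.\<close>

lemma exists_self_similar_subset:
  assumes ne: "sft_attractor M A S \<noteq> {}" and s: "ereal s < hausdorff_dim (sft_attractor M A S)"
    and nej: "sft_attractor_at M A S j \<noteq> {}"
  shows "\<exists>\<rho> Q m v' S' K. 0 < \<rho> \<and> \<rho> < 1 \<and>
     Q \<in> sft_transformation_group M A T j \<inter> {R. rotation_matrix R} \<and>
     ss_ifs m (\<lambda>_. \<rho>) (\<lambda>_. Q) v' S' \<and> is_attractor m S' K \<and> strong_separation m S' K \<and>
     K \<subseteq> sft_attractor_at M A S j \<and> ereal s \<le> hausdorff_dim K \<and>
     dense_subset (ifs_transformation_group m (\<lambda>_. Q)) (sft_transformation_group M A T j \<inter> {R. rotation_matrix R})"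
proof -
  obtain X \<kappa> where X: "finite X" "X \<subseteq> loops" "disjoint_family_on piece X" and \<kappa>: "0 < \<kappa>"
    and Xrot: "\<And>w. w \<in> X \<Longrightarrow> rotation_matrix (orth T w) \<and> \<kappa> \<le> ratio w"
    and bigX: "1 < real (card X) * \<kappa> powr s"
    using exists_separated_rotation_loops[OF ne s] by blast
  obtain Y \<zeta> where Y: "finite Y" "Y \<subseteq> loops" "disjoint_family_on piece Y"
    and Ymult: "\<And>w. w \<in> Y \<Longrightarrow> multiplier w \<zeta>" and bigY: "1 < real (card Y) * norm \<zeta> powr s"
    using exists_common_multiplier[OF X \<kappa> Xrot bigX] by blast
  have "Y \<noteq> {}" using bigY by auto
  then obtain w0 where w0: "w0 \<in> Y" by auto
  have \<zeta>0: "\<zeta> \<noteq> 0" and "orth T w0 = rot (sgn \<zeta>)" using Ymult[OF w0] by (auto simp: multiplier_def)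
  moreover have "norm (sgn \<zeta>) = 1" using \<zeta>0 by (simp add: norm_sgn)
  moreover have "w0 \<in> loops" using w0 Y(2) by auto
  ultimately obtain wp p where wp: "wp \<in> loops" "norm p = 1" "orth T wp = rot p"
    and dense: "\<And>L0. \<exists>L\<ge>L0. dense_subset (generate orthogonal_group {rot (sgn \<zeta> ^ L * p)})
             (sft_transformation_group M A T j \<inter> {R. rotation_matrix R})"
    using exists_dense_loop[of w0 "sgn \<zeta>"] by blast
  have wpM: "set wp \<subseteq> {..<M}" by (rule loops_alphabet[OF wp(1)])
  have rp: "0 < ratio wp" by (rule ratio_pos[OF wpM])
  obtain L0 where L0: "1 / ratio wp powr s < (real (card Y) * norm \<zeta> powr s) ^ L0"
    using real_arch_pow[OF bigY] by blast
  obtain L where L: "L0 \<le> L" and denseL: "dense_subset (generate orthogonal_group {rot (sgn \<zeta> ^ L * p)})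
             (sft_transformation_group M A T j \<inter> {R. rotation_matrix R})"
    using dense by blast
  have "(real (card Y) * norm \<zeta> powr s) ^ L0 \<le> (real (card Y) * norm \<zeta> powr s) ^ L"
    using L bigY by (intro power_increasing) auto
  with L0 have "1 / ratio wp powr s < (real (card Y) * norm \<zeta> powr s) ^ L" by simp
  then have bigL: "1 < (real (card Y) * norm \<zeta> powr s) ^ L * ratio wp powr s"
    using rp by (simp add: field_simps)
  define m where "m = card Y ^ L"
  have cardW: "card (words_of_length Y L) = m"
    using card_lists_length_eq[OF Y(1), of L] by (simp add: m_def words_of_length_def)
  have finW: "finite (words_of_length Y L)"
    using finite_lists_length_eq[OF Y(1), of L] by (simp add: words_of_length_def)
  have m1: "1 \<le> m" using \<open>Y \<noteq> {}\<close> Y(1) by (simp add: m_def card_gt_0_iff Suc_le_eq)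
  obtain e where e: "bij_betw e {1..m} (words_of_length Y L)"
    using ex_bij_betw_nat_finite_1[OF finW] cardW by auto
  define word where "word = (\<lambda>i. concat (e i) @ wp)"
  define \<rho> where "\<rho> = norm \<zeta> ^ L * ratio wp"
  define Q where "Q = rot (sgn \<zeta> ^ L * p)"
  define S' where "S' = (\<lambda>i. comp_word S (word i))"
  have e_in: "set (e i) \<subseteq> Y" "length (e i) = L" if "i \<in> {1..m}" for i
    using bij_betwE[OF e] that by (simp_all add: words_of_length_def)
  have word_loop: "word i \<in> loops" if "i \<in> {1..m}" for i
  proof (cases "e i = []")
    case False
    then show ?thesis using concat_loops[OF e_in(1)[OF that] Y(2)] wp(1) by (simp add: word_def loops_append)
  qed (simp add: word_def wp(1))
  have word_lin: "ratio (word i) = \<rho>" "orth T (word i) = Q" if "i \<in> {1..m}" for i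
  proof -
    have "multiplier (concat (e i)) (prod_list (map (\<lambda>_. \<zeta>) (e i)))"
      using e_in(1)[OF that] Ymult by (intro multiplier_concat) auto
    then have "multiplier (concat (e i)) (\<zeta> ^ L)" by (simp add: map_replicate_const e_in(2)[OF that])
    moreover have "sgn (\<zeta> ^ n) = sgn \<zeta> ^ n" for n by (induction n) (simp_all add: sgn_mult)
    ultimately show "ratio (word i) = \<rho>" "orth T (word i) = Q"
      by (simp_all add: multiplier_def word_def \<rho>_def Q_def norm_power wp(3) rot_mirror_mult)
  qed
  have \<rho>: "0 < \<rho>" "\<rho> < 1"
  proof -
    have i1: "1 \<in> {1..m}" using m1 by simp
    show "\<rho> < 1" using loop_ratio_less_1[OF word_loop[OF i1]] word_lin(1)[OF i1] by simp
    show "0 < \<rho>" using \<zeta>0 rp by (simp add: \<rho>_def)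
  qed
  have disj: "disjoint_family_on (\<lambda>i. S' i ` cball 0 R) {1..m}"
    unfolding disjoint_family_on_def
  proof (intro ballI impI)
    fix a b assume ab: "a \<in> {1..m}" "b \<in> {1..m}" "a \<noteq> b"
    have "e a \<noteq> e b" using bij_betw_imp_inj_on[OF e] ab by (simp add: inj_on_eq_iff)
    moreover have "e a \<in> words_of_length Y L" "e b \<in> words_of_length Y L"
      using e_in[OF ab(1)] e_in[OF ab(2)] by (simp_all add: words_of_length_def)
    ultimately show "S' a ` cball 0 R \<inter> S' b ` cball 0 R = {}"
      using disjoint_concat[OF Y(2,3) wpM, of L] unfolding disjoint_family_on_def S'_def word_def by simp
  qed
  have ms: "1 \<le> real m * \<rho> powr s"
  proof -
    have "(norm \<zeta> ^ L) powr s = (norm \<zeta> powr s) ^ L"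
      using \<zeta>0 by (simp add: powr_powr powr_realpow[symmetric] mult.commute)
    then have "real m * \<rho> powr s = (real (card Y) * norm \<zeta> powr s) ^ L * ratio wp powr s"
      using rp \<zeta>0 by (simp add: m_def \<rho>_def powr_mult power_mult_distrib)
    then show ?thesis using bigL by simp
  qed
  have "\<exists>K. is_attractor m S' K \<and> strong_separation m S' K \<and> K \<subseteq> sft_attractor_at M A S j \<and> ereal s \<le> hausdorff_dim K"
  proof (rule equal_ratio_attractor[OF m1 \<rho> R0 _ _ disj closed_sft_attractor_at nej _ ms])
    fix i assume i: "i \<in> {1..m}"
    note wM = loops_alphabet[OF word_loop[OF i]]
    show "dist (S' i x) (S' i y) = \<rho> * dist x y" for x y
      unfolding S'_def dist_comp_word[OF wM] word_lin(1)[OF i] ..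
    show "norm (S' i x) \<le> R" if "norm x \<le> R" for x
      using comp_word_ball[OF wM, of x] that by (simp add: S'_def)
    show "S' i y \<in> sft_attractor_at M A S j" if "y \<in> sft_attractor_at M A S j" for y
      unfolding S'_def by (rule sft_attractor_at_invariant[OF word_loop[OF i] that])
  qed
  then obtain K where K: "is_attractor m S' K" "strong_separation m S' K" "K \<subseteq> sft_attractor_at M A S j"
    "ereal s \<le> hausdorff_dim K" by blast
  have ss: "ss_ifs m (\<lambda>_. \<rho>) (\<lambda>_. Q) (\<lambda>i. S' i 0) S'"
    unfolding ss_ifs_def
  proof (intro conjI ballI)
    fix i assume i: "i \<in> {1..m}"
    note wM = loops_alphabet[OF word_loop[OF i]]
    show "orthogonal_matrix Q" using orthogonal_orth[OF wM] word_lin(2)[OF i] by simp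
    show "S' i = similarity \<rho> Q (S' i 0)"
      using comp_word_similarity[OF wM] unfolding S'_def word_lin[OF i] .
  qed (use m1 \<rho> in auto)
  have "Q \<in> generate orthogonal_group {Q}" by (rule generate.incl) simp
  then have "Q \<in> sft_transformation_group M A T j \<inter> {R. rotation_matrix R}"
    using denseL unfolding dense_subset_def Q_def by blast
  moreover have "(\<lambda>_. Q) ` {1..m} = {Q}" using m1 by auto
  then have "dense_subset (ifs_transformation_group m (\<lambda>_. Q)) (sft_transformation_group M A T j \<inter> {R. rotation_matrix R})"
    using denseL by (simp add: ifs_transformation_group_def Q_def)
  ultimately show ?thesis using \<rho> ss K by blast
qed

text \<open>Subtracting \<open>\<epsilon>\<close> is only meaningful for a finite dimension. The \<open>M ^ k\<close> pieces of words of length \<open>k\<close>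
  cover the attractor, and their diameters are at most \<open>2 R c ^ k\<close>; so the dimension cannot exceed an
  exponent \<open>t\<close> with \<open>M c powr t < 1\<close>.\<close>

lemma hausdorff_dim_sft_attractor_finite:
  assumes ne: "sft_attractor M A S \<noteq> {}"
  shows "hausdorff_dim (sft_attractor M A S) \<noteq> \<infinity>"
proof
  assume inf: "hausdorff_dim (sft_attractor M A S) = \<infinity>"
  have cpos: "0 < c" using c0 j by auto
  \<comment> \<open>chosen such that c powr t = 1 / (2 M)\<close>
  define t where "t = ln (2 * real M) / ln (1 / c)"
  have "0 < ln (1 / c)" using cpos c1 by simp
  then have "c powr t = 1 / (2 * real M)"
    using cpos j by (simp add: powr_def t_def ln_div exp_minus field_simps)
  then have half: "real M * c powr t = 1 / 2" using j by simp
  obtain c' \<delta>0 where c': "0 < c'" and \<delta>0: "0 < \<delta>0"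
    and cov: "\<And>\<delta> \<U>. 0 < \<delta> \<Longrightarrow> \<delta> \<le> \<delta>0 \<Longrightarrow> finite \<U> \<Longrightarrow> sft_attractor M A S \<subseteq> \<Union>\<U> \<Longrightarrow>
        (\<forall>U\<in>\<U>. bounded U \<and> diameter U \<le> \<delta>) \<Longrightarrow> c' \<le> real (card \<U>) * \<delta> powr t"
    using finite_cover_card_lower_bound[OF ne, of t] inf by auto
  have ne_al: "{..<M} \<noteq> {}" using j by auto
  have "\<forall>\<^sub>F k in sequentially. 2 * R * c ^ k < \<delta>0"
    using pow_c_tendsto[OF ne_al] \<delta>0 by (rule order_tendstoD(2))
  moreover have "(\<lambda>k. (2 * R) powr t * (1 / 2) ^ k) \<longlonglongrightarrow> 0"
    by (intro tendsto_mult_right_zero LIMSEQ_power_zero) simp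
  then have "\<forall>\<^sub>F k in sequentially. (2 * R) powr t * (1 / 2) ^ k < c'"
    using c' by (rule order_tendstoD(2))
  ultimately have "\<forall>\<^sub>F k in sequentially. 2 * R * c ^ k < \<delta>0 \<and> (2 * R) powr t * (1 / 2) ^ k < c'"
    by (rule eventually_conj)
  then obtain k where k: "2 * R * c ^ k < \<delta>0" "(2 * R) powr t * (1 / 2) ^ k < c'"
    unfolding eventually_sequentially by blast
  define \<U> where "\<U> = piece ` words_of_length {..<M} k"
  have finW: "finite (words_of_length {..<M} k)"
    unfolding words_of_length_def by (rule finite_lists_length_eq) simp
  have cardW: "card (words_of_length {..<M} k) = M ^ k"
    using card_lists_length_eq[of "{..<M}" k] by (simp add: words_of_length_def)
  have "c' \<le> real (card \<U>) * (2 * R * c ^ k) powr t"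
  proof (rule cov)
    show "0 < 2 * R * c ^ k" using R0 cpos by simp
    show "2 * R * c ^ k \<le> \<delta>0" using k(1) by simp
    show "finite \<U>" unfolding \<U>_def by (rule finite_imageI[OF finW])
    show "sft_attractor M A S \<subseteq> \<Union>\<U>"
    proof
      fix x assume "x \<in> sft_attractor M A S"
      then obtain \<alpha> where \<alpha>: "\<alpha> \<in> sft M A" "x = coding_map S \<alpha>" unfolding sft_attractor_def by blast
      have seq: "\<alpha> \<in> sequences" using \<alpha>(1) sft_sequences by blast
      have "prefix_of \<alpha> k \<in> words_of_length {..<M} k"
        using set_prefix_of[OF seq] by (simp add: words_of_length_def)
      moreover have "x \<in> piece (prefix_of \<alpha> k)" unfolding \<alpha>(2) by (rule coding_map_in_piece[OF \<alpha>(1)])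
      ultimately show "x \<in> \<Union>\<U>" unfolding \<U>_def by blast
    qed
    show "\<forall>U\<in>\<U>. bounded U \<and> diameter U \<le> 2 * R * c ^ k"
    proof
      fix U assume "U \<in> \<U>"
      then obtain w where w: "set w \<subseteq> {..<M}" "length w = k" "U = piece w"
        unfolding \<U>_def words_of_length_def by blast
      have "dist x y \<le> 2 * R * c ^ k" if "x \<in> U" "y \<in> U" for x y
      proof -
        have "dist x y \<le> ratio w * (2 * R)" using dist_in_piece[OF w(1)] that w(3) by simp
        also have "\<dots> \<le> c ^ k * (2 * R)"
          using ratio_le[OF w(1)] w(2) R0 by (intro mult_right_mono) auto
        finally show ?thesis by (simp add: mult.commute)
      qed
      moreover have "U \<noteq> {}" unfolding w(3) by (rule piece_nonempty)
      moreover have "U \<subseteq> cball 0 R" unfolding w(3) using comp_word_ball[OF w(1)] by blast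
      ultimately show "bounded U \<and> diameter U \<le> 2 * R * c ^ k"
        using bounded_subset[OF bounded_cball] by (auto intro!: diameter_le simp: dist_norm)
    qed
  qed
  also have "\<dots> \<le> real (M ^ k) * (2 * R * c ^ k) powr t"
    using card_image_le[OF finW, of piece] cardW unfolding \<U>_def by (intro mult_right_mono) auto
  also have "(2 * R * c ^ k) powr t = (2 * R) powr t * (c powr t) ^ k"
    using R0 cpos by (simp add: powr_mult powr_powr powr_realpow[symmetric] mult.commute)
  also have "real (M ^ k) * ((2 * R) powr t * (c powr t) ^ k) = (2 * R) powr t * (real M * c powr t) ^ k"
    by (simp add: power_mult_distrib)
  also have "\<dots> < c'" using k(2) by (simp add: half)
  finally show False by simp
qed

lemma sft_attractor_at_nonempty: "sft_attractor_at M A S i \<noteq> {} \<Longrightarrow> i < M \<Longrightarrow> sft_attractor_at M A S j \<noteq> {}"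
proof -
  assume "sft_attractor_at M A S i \<noteq> {}" "i < M"
  then obtain \<alpha> where \<alpha>: "\<alpha> \<in> sft M A" "\<alpha> 0 = i" by (auto simp: sft_attractor_at_def)
  obtain w where "walk M A j w i" using exists_walk[OF A irr j \<open>i < M\<close>] by blast
  from walk_coding_map[OF this \<alpha>] show ?thesis by (auto simp: sft_attractor_at_def)
qed

end

section \<open>Approximation from inside\<close>

theorem theorem1p20:
  fixes M j :: nat and A :: "nat mat"
    and r :: "nat \<Rightarrow> real" and T :: "nat \<Rightarrow> real^2^2" and v :: "nat \<Rightarrow> real^2"
    and S :: "nat \<Rightarrow> real^2 \<Rightarrow> real^2" and \<epsilon> :: real
  assumes "zero_one_matrix M A"
    and "irreducible_sft M A"
    and "\<And>i. i < M \<Longrightarrow> 0 < r i \<and> r i < 1"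
    and "\<And>i. i < M \<Longrightarrow> orthogonal_matrix (T i)"
    and "\<And>i. i < M \<Longrightarrow> S i = similarity (r i) (T i) (v i)"
    and "\<exists>i<M. \<exists>x\<in>sft_attractor_at M A S i. \<exists>y\<in>sft_attractor_at M A S i. x \<noteq> y"
    and "j < M"
    and "\<epsilon> > 0"
  shows "\<exists>(\<rho> :: real) (Q :: real^2^2) (m :: nat) (r' :: nat \<Rightarrow> real) (T' :: nat \<Rightarrow> real^2^2)
           (v' :: nat \<Rightarrow> real^2) (S' :: nat \<Rightarrow> real^2 \<Rightarrow> real^2) (K :: (real^2) set).
           0 < \<rho> \<and> \<rho> < 1 \<and>
           Q \<in> sft_transformation_group M A T j \<inter> {R. rotation_matrix R} \<and>
           ss_ifs m r' T' v' S' \<and>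
           is_attractor m S' K \<and>
           strong_separation m S' K \<and>
           K \<subseteq> sft_attractor_at M A S j \<and>
           sft_attractor_at M A S j \<subseteq> sft_attractor M A S \<and>
           hausdorff_dim (sft_attractor M A S) - ereal \<epsilon> < hausdorff_dim K \<and>
           dense_subset (ifs_transformation_group m T')
             (sft_transformation_group M A T j \<inter> {R. rotation_matrix R}) \<and>
           (\<forall>i\<in>{1..m}. T' i = Q \<and> r' i = \<rho>)"
proof -
  interpret graph_directed_similarities M A r T v S j
    using assms(1-5,7) by unfold_locales
  obtain i where "i < M" "sft_attractor_at M A S i \<noteq> {}" using assms(6) by blast
  then have nej: "sft_attractor_at M A S j \<noteq> {}" using sft_attractor_at_nonempty by blast
  have sub: "sft_attractor_at M A S j \<subseteq> sft_attractor M A S"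
    unfolding sft_attractor_at_def sft_attractor_def by (rule image_mono) blast
  with nej have ne: "sft_attractor M A S \<noteq> {}" by blast
  obtain d where d: "hausdorff_dim (sft_attractor M A S) = ereal d"
    using hausdorff_dim_nonneg[of "sft_attractor M A S"] hausdorff_dim_sft_attractor_finite[OF ne]
    by (cases "hausdorff_dim (sft_attractor M A S)") auto
  have "ereal (d - \<epsilon> / 2) < hausdorff_dim (sft_attractor M A S)" using d assms(8) by simp
  from exists_self_similar_subset[OF ne this nej]
  obtain \<rho> Q m v' S' K where res: "0 < \<rho>" "\<rho> < 1"
     "Q \<in> sft_transformation_group M A T j \<inter> {R. rotation_matrix R}"
     "ss_ifs m (\<lambda>_. \<rho>) (\<lambda>_. Q) v' S'" "is_attractor m S' K" "strong_separation m S' K"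
     "K \<subseteq> sft_attractor_at M A S j" and dim: "ereal (d - \<epsilon> / 2) \<le> hausdorff_dim K" and
     dense: "dense_subset (ifs_transformation_group m (\<lambda>_. Q)) (sft_transformation_group M A T j \<inter> {R. rotation_matrix R})"
    by (elim exE conjE)
  have "hausdorff_dim (sft_attractor M A S) - ereal \<epsilon> < ereal (d - \<epsilon> / 2)" using d assms(8) by simp
  then have "hausdorff_dim (sft_attractor M A S) - ereal \<epsilon> < hausdorff_dim K" using dim by (rule less_le_trans)
  with res sub dense show ?thesis
    by (intro exI[of _ \<rho>] exI[of _ Q] exI[of _ m] exI[of _ "\<lambda>_. \<rho>"] exI[of _ "\<lambda>_. Q"]
        exI[of _ v'] exI[of _ S'] exI[of _ K] conjI ballI) simp_all
qed

end
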